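(* Consider the $n$-person affine-quadratic dynamic game described in the context, with feedback information pattern, player 1 as leader and players $2,\dots,n$ as followers; write $F=\{2,\dots,n\}$. Assume that (1) $Q_k^i\ge0$, $R_k^{ii}>0$ and $R_k^{ij}\ge0$ for all $k\in K$, $i,j\in N$, $j\neq i$; (2) for every $k\in K$ (going backward from $T$ to $1$) the following systems, for $i\in F$, admit unique solutions $\bar r_k^i$, $W_k^i$, $w_k^i$, $P_k^{i*}$, $\alpha_k^{i*}$: $$\bar r_k^i=-(R_k^{ii}+B_k^{i'}Z_k^iB_k^i)^{-1}B_k^{i'}Z_k^i\Big(B_k^1+\sum_{j\in F,j\ne i}B_k^j\bar r_k^j\Big),$$ $$W_k^i=-(R_k^{ii}+B_k^{i'}Z_k^iB_k^i)^{-1}B_k^{i'}Z_k^i\Big(\sum_{j\in F,j\ne i}B_k^jW_k^j+A_k\Big),$$ $$w_k^i=-(R_k^{ii}+B_k^{i'}Z_k^iB_k^i)^{-1}\Big[B_k^{i'}\Big(Z_k^i\big(\sum_{j\in F,j\ne i}B_k^jw_k^j+s_k\big)+\zeta_k^i-Q_k^i\tilde x_k^i\Big)-R_k^{ii}\tilde u_k^{ii}\Big],$$ $$P_k^{i*}=(R_k^{ii}+B_k^{i'}Z_k^iB_k^i)^{-1}B_k^{i'}Z_k^i\Big(A_k-B_k^1P_k^{1*}-\sum_{j\in F,j\ne i}B_k^jP_k^{j*}\Big)=-W_k^i+\bar r_k^iP_k^{1*},$$ $$\alpha_k^{i*}=(R_k^{ii}+B_k^{i'}Z_k^iB_k^i)^{-1}\Big[B_k^{i'}\Big(Z_k^i\big(s_k-B_k^1\alpha_k^{1*}-\sum_{j\in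 F,j\ne i}B_k^j\alpha_k^{j*}\big)+\zeta_k^i-Q_k^i\tilde x_k^i\Big)-R_k^{ii}\tilde u_k^{ii}\Big]=-w_k^i+\bar r_k^i\alpha_k^{1*}.$$ Here, with $\bar B_k:=B_k^1+\sum_{j\in F}B_k^j\bar r_k^j$ and $\Delta_k:=\bar B_k'Z_k^1\bar B_k+R_k^{11}+\sum_{j\in F}\bar r_k^{j'}R_k^{1j}\bar r_k^j$, $$P_k^{1*}=\Delta_k^{-1}\Big[\bar B_k'Z_k^1\big(A_k+\sum_{j\in F}B_k^jW_k^j\big)+\sum_{j\in F}\bar r_k^{j'}R_k^{1j}W_k^j\Big],$$ $$\alpha_k^{1*}=\Delta_k^{-1}\Big[\bar B_k'Z_k^1\big(s_k+\sum_{j\in F}B_k^jw_k^j\big)+\sum_{j\in F}\bar r_k^{j'}R_k^{1j}w_k^j-R_k^{11}\tilde u_k^{11}-\sum_{j\in F}\bar r_k^{j'}R_k^{1j}\tilde u_k^{1j}+\bar B_k'(\zeta_k^1-Q_k^1\tilde x_k^1)\Big],$$ and for $i\in N$ $$Z_{k-1}^i=\Big(A_k-\sum_{j\in N}B_k^jP_k^{j*}\Big)'Z_k^i\Big(A_k-\sum_{j\in N}B_k^jP_k^{j*}\Big)+\sum_{j\in N}P_k^{j*'}R_k^{ij}P_k^{j*}+Q_{k-1}^i,\qquad Z_T^i=Q_T^i,$$ $$\zeta_{k-1}^i=\Big(A_k-\sum_{j\in N}B_k^jP_k^{j*}\Big)'\Big[\zeta_k^i+Z_k^i\big(s_k-\sum_{j\in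 N}B_k^j\alpha_k^{j*}\big)-Q_k^i\tilde x_k^i\Big]+\sum_{j\in N}P_k^{j*'}R_k^{ij}(\alpha_k^{j*}+\tilde u_k^{ij}),\qquad\zeta_T^i=0.$$ Then the game admits a unique feedback Stackelberg equilibrium solution with player 1 as leader and players $2,\dots,n$ as followers. The unique equilibrium strategies are $$\gamma_k^{i*}(x_{k-1})=-P_k^{i*}x_{k-1}-\alpha_k^{i*},\qquad k\in K,\ i\in N,$$ and the feedback Stackelberg equilibrium cost of player $i\in N$ is $$V^i(1,x_0)=\tfrac12x_0'Z_0^ix_0+\zeta_0^{i'}x_0+n_0^i,$$ where, with $\bar s_k:=s_k-\sum_{j\in N}B_k^j\alpha_k^{j*}$, $$n_{k-1}^i=n_k^i+\tfrac12\bar s_k'Z_k^i\bar s_k+\zeta_k^{i'}\bar s_k+\tfrac12\sum_{j\in N}\alpha_k^{j*'}R_k^{ij}\alpha_k^{j*}-\tilde x_k^{i'}Q_k^i\bar s_k+\sum_{j\in N}\tilde u_k^{ij'}R_k^{ij}\alpha_k^{j*}+\tfrac12\Big(\tilde x_k^{i'}Q_k^i\tilde x_k^i+\sum_{j\in N}\tilde u_k^{ij'}R_k^{ij}\tilde u_k^{ij}\Big),\qquad n_T^i=0.$$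
   Context: A prime denotes transpose; for symmetric matrices $>0$ means positive definite and $\ge0$ positive semidefinite. Affine-quadratic game: players $N=\{1,\dots,n\}$, stages $K=\{1,\dots,T\}$, states $x_k\in\mathbb R^p$, controls $u_k^i\in\mathbb R^{m_i}$, dynamics $x_k=f_{k-1}(x_{k-1},u_k^1,\dots,u_k^n)=A_kx_{k-1}+\sum_{j\in N}B_k^ju_k^j+s_k$ with $x_0$ given. Player $i$ minimizes $L^i=\sum_{k=1}^Tg_k^i(x_k,u_k^1,\dots,u_k^n,x_{k-1})$ with $$g_k^i=\tfrac12\Big(x_k'Q_k^ix_k+\sum_{j\in N}u_k^{j'}R_k^{ij}u_k^j\Big)+\tfrac12\Big(\tilde x_k^{i'}Q_k^i\tilde x_k^i+\sum_{j\in N}\tilde u_k^{ij'}R_k^{ij}\tilde u_k^{ij}\Big)-\tilde x_k^{i'}Q_k^ix_k-\sum_{j\in N}\tilde u_k^{ij'}R_k^{ij}u_k^j .$$ The $A_k,B_k^i,Q_k^i,R_k^{ij},s_k,\tilde x_k^i,\tilde u_k^{ij}$ are given matrices/vectors of appropriate dimensions, with $Q_k^i,R_k^{ij}$ symmetric. Convention: $Q_0^i:=0$. Feedback information pattern: at stage $k$ each player knows $x_{k-1}$ and uses $u_k^i=\gamma_k^i(x_{k-1})$. Feedback Stackelberg equilibrium (leader 1): strategies $\{\gamma_k^{i*}\}$ for which there are functions $V^i(k,\cdot):\mathbb R^p\to\mathbb R$ with $V^i(T+1,\cdot)=0$ such that, setting $J_k^i(x,u^1,\dots,u^n)=g_k^i(f_{k-1}(x,u^1,\dots,u^n),u^1,\dots,u^n,x)+V^i(k+1,f_{k-1}(x,u^1,\dots,u^n))$,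 for all $k\in K$ and $x$: (a) for each $u^1$ there is a unique tuple of follower responses $(r_k^2(u^1),\dots,r_k^n(u^1))$ such that each $r_k^i(u^1)$ minimizes $u^i\mapsto J_k^i$ when the leader plays $u^1$ and the other followers $j$ play $r_k^j(u^1)$; (b) $\gamma_k^{1*}(x)$ minimizes $u^1\mapsto J_k^1(x,u^1,r_k^2(u^1),\dots,r_k^n(u^1))$; (c) $\gamma_k^{i*}(x)=r_k^i(\gamma_k^{1*}(x))$ for $i\ge2$; (d) $V^i(k,x)=J_k^i(x,\gamma_k^{1*}(x),\dots,\gamma_k^{n*}(x))$ for all $i\in N$. The equilibrium cost of player $i$ is $V^i(1,x_0)$. *)

theory Defs
  imports "Jordan_Normal_Form.Gauss_Jordan_Elimination" "HOL-Library.FuncSet"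
begin

(* The control dimensions depend on the player, so matrices and vectors carry their
   dimensions explicitly (carrier_mat, carrier_vec) instead of in their types. *)

abbreviation vsum :: "nat \<Rightarrow> ('i \<Rightarrow> real vec) \<Rightarrow> 'i set \<Rightarrow> real vec" where
  "vsum d \<equiv> finsum_vec TYPE(real) d"

abbreviation msum :: "nat \<Rightarrow> nat \<Rightarrow> ('i \<Rightarrow> real mat) \<Rightarrow> 'i set \<Rightarrow> real mat" where
  "msum nr nc \<equiv> finsum (module_mat TYPE(real) nr nc)"

(* Meaningful for invertible square matrices only; unspecified otherwise. *)
definition minv :: "real mat \<Rightarrow> real mat" where
  "minv M = the (mat_inverse M)"

definition sym_mat :: "nat \<Rightarrow> real mat \<Rightarrow> bool" where
  "sym_mat d M \<longleftrightarrow> M \<in> carrier_mat d d \<and> M\<^sup>T = M"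

definition pos_semidef :: "nat \<Rightarrow> real mat \<Rightarrow> bool" where
  "pos_semidef d M \<longleftrightarrow> sym_mat d M \<and> (\<forall>x \<in> carrier_vec d. 0 \<le> x \<bullet> (M *\<^sub>v x))"

definition pos_def :: "nat \<Rightarrow> real mat \<Rightarrow> bool" where
  "pos_def d M \<longleftrightarrow> sym_mat d M \<and>
     (\<forall>x \<in> carrier_vec d. x \<noteq> 0\<^sub>v d \<longrightarrow> 0 < x \<bullet> (M *\<^sub>v x))"

(* Argument order of the data: stage k, then player i, then (for R and utgt) player j.
   xtgt and utgt are the targets written with a tilde. *)
record aq_game =
  nplayers :: nat
  nstages :: nat
  sdim :: nat
  cdim :: "nat \<Rightarrow> nat"
  Amat :: "nat \<Rightarrow> real mat"
  Bmat :: "nat \<Rightarrow> nat \<Rightarrow> real mat"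
  svec :: "nat \<Rightarrow> real vec"
  Qmat :: "nat \<Rightarrow> nat \<Rightarrow> real mat"
  Rmat :: "nat \<Rightarrow> nat \<Rightarrow> nat \<Rightarrow> real mat"
  xtgt :: "nat \<Rightarrow> nat \<Rightarrow> real vec"
  utgt :: "nat \<Rightarrow> nat \<Rightarrow> nat \<Rightarrow> real vec"
  xinit :: "real vec"

definition players :: "aq_game \<Rightarrow> nat set" where
  "players G = {1..nplayers G}"

definition followers :: "aq_game \<Rightarrow> nat set" where
  "followers G = {2..nplayers G}"

definition stages :: "aq_game \<Rightarrow> nat set" where
  "stages G = {1..nstages G}"

definition affine_quadratic_game :: "aq_game \<Rightarrow> bool" where
  "affine_quadratic_game G \<longleftrightarrow>
     1 \<le> nplayers G \<and>
     xinit G \<in> carrier_vec (sdim G) \<and>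
     (\<forall>k \<in> stages G.
        Amat G k \<in> carrier_mat (sdim G) (sdim G) \<and>
        svec G k \<in> carrier_vec (sdim G) \<and>
        (\<forall>i \<in> players G.
           Bmat G k i \<in> carrier_mat (sdim G) (cdim G i) \<and>
           sym_mat (sdim G) (Qmat G k i) \<and>
           xtgt G k i \<in> carrier_vec (sdim G) \<and>
           (\<forall>j \<in> players G.
              sym_mat (cdim G j) (Rmat G k i j) \<and>
              utgt G k i j \<in> carrier_vec (cdim G j)))) \<and>
     (\<forall>i \<in> players G. Qmat G 0 i = 0\<^sub>m (sdim G) (sdim G))"

(* A control profile u at one stage maps each player j to u j; only the values at
   j in players G matter. *)
definition next_state :: "aq_game \<Rightarrow> nat \<Rightarrow> real vec \<Rightarrow> (nat \<Rightarrow> real vec) \<Rightarrow> real vec" where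
  "next_state G k x u =
     Amat G k *\<^sub>v x + vsum (sdim G) (\<lambda>j. Bmat G k j *\<^sub>v u j) (players G) + svec G k"

(* Here y is the state reached at stage k; the previous state does not enter the cost. *)
definition stage_cost :: "aq_game \<Rightarrow> nat \<Rightarrow> nat \<Rightarrow> real vec \<Rightarrow> (nat \<Rightarrow> real vec) \<Rightarrow> real" where
  "stage_cost G k i y u =
     1/2 * (y \<bullet> (Qmat G k i *\<^sub>v y) + (\<Sum>j\<in>players G. u j \<bullet> (Rmat G k i j *\<^sub>v u j)))
     + 1/2 * (xtgt G k i \<bullet> (Qmat G k i *\<^sub>v xtgt G k i)
              + (\<Sum>j\<in>players G. utgt G k i j \<bullet> (Rmat G k i j *\<^sub>v utgt G k i j)))
     - xtgt G k i \<bullet> (Qmat G k i *\<^sub>v y)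
     - (\<Sum>j\<in>players G. utgt G k i j \<bullet> (Rmat G k i j *\<^sub>v u j))"

(* Value functions are written V i k x. *)
definition cost_to_go ::
  "aq_game \<Rightarrow> (nat \<Rightarrow> nat \<Rightarrow> real vec \<Rightarrow> real) \<Rightarrow> nat \<Rightarrow> nat \<Rightarrow> real vec \<Rightarrow> (nat \<Rightarrow> real vec) \<Rightarrow> real" where
  "cost_to_go G V k i x u =
     stage_cost G k i (next_state G k x u) u + V i (k + 1) (next_state G k x u)"

(* r is a Nash equilibrium among the followers when the leader plays u1; PiE makes the
   tuple indexed by the followers a unique object. *)
definition follower_response ::
  "aq_game \<Rightarrow> (nat \<Rightarrow> nat \<Rightarrow> real vec \<Rightarrow> real) \<Rightarrow> nat \<Rightarrow> real vec \<Rightarrow> real vec \<Rightarrow> (nat \<Rightarrow> real vec) \<Rightarrow> bool" where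
  "follower_response G V k x u1 r \<longleftrightarrow>
     r \<in> PiE (followers G) (\<lambda>i. carrier_vec (cdim G i)) \<and>
     (\<forall>i \<in> followers G.
        is_arg_min (\<lambda>v. cost_to_go G V k i x (r(1 := u1, i := v)))
          (\<lambda>v. v \<in> carrier_vec (cdim G i)) (r i))"

definition reaction ::
  "aq_game \<Rightarrow> (nat \<Rightarrow> nat \<Rightarrow> real vec \<Rightarrow> real) \<Rightarrow> nat \<Rightarrow> real vec \<Rightarrow> real vec \<Rightarrow> (nat \<Rightarrow> real vec)" where
  "reaction G V k x u1 = (THE r. follower_response G V k x u1 r)"

(* Strategies are written \<gamma> k i x, where x is the state at stage k - 1. *)
definition stackelberg_values ::
  "aq_game \<Rightarrow> (nat \<Rightarrow> nat \<Rightarrow> real vec \<Rightarrow> real vec) \<Rightarrow> (nat \<Rightarrow> nat \<Rightarrow> real vec \<Rightarrow> real) \<Rightarrow> bool" where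
  "stackelberg_values G \<gamma> V \<longleftrightarrow>
     (\<forall>i \<in> players G. \<forall>x \<in> carrier_vec (sdim G). V i (nstages G + 1) x = 0) \<and>
     (\<forall>k \<in> stages G. \<forall>x \<in> carrier_vec (sdim G).
        (\<forall>u1 \<in> carrier_vec (cdim G 1). \<exists>!r. follower_response G V k x u1 r) \<and>
        is_arg_min (\<lambda>u1. cost_to_go G V k 1 x ((reaction G V k x u1)(1 := u1)))
          (\<lambda>u1. u1 \<in> carrier_vec (cdim G 1)) (\<gamma> k 1 x) \<and>
        (\<forall>i \<in> followers G. \<gamma> k i x = reaction G V k x (\<gamma> k 1 x) i) \<and>
        (\<forall>i \<in> players G. V i k x = cost_to_go G V k i x (\<lambda>j. \<gamma> k j x)))"

definition feedback_stackelberg :: "aq_game \<Rightarrow> (nat \<Rightarrow> nat \<Rightarrow> real vec \<Rightarrow> real vec) \<Rightarrow> bool" where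
  "feedback_stackelberg G \<gamma> \<longleftrightarrow> (\<exists>V. stackelberg_values G \<gamma> V)"

definition unique_solution_on :: "'i set \<Rightarrow> (('i \<Rightarrow> 'a) \<Rightarrow> bool) \<Rightarrow> ('i \<Rightarrow> 'a) \<Rightarrow> bool" where
  "unique_solution_on F S f \<longleftrightarrow> S f \<and> (\<forall>f'. S f' \<longrightarrow> (\<forall>i \<in> F. f' i = f i))"

(* Below, the arguments Z, \<zeta>, r, W, w, P, \<alpha> are the families at the single stage k,
   indexed by players. *)

definition Hinv :: "aq_game \<Rightarrow> nat \<Rightarrow> (nat \<Rightarrow> real mat) \<Rightarrow> nat \<Rightarrow> real mat" where
  "Hinv G k Z i = minv (Rmat G k i i + (Bmat G k i)\<^sup>T * Z i * Bmat G k i)"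

definition r_system :: "aq_game \<Rightarrow> nat \<Rightarrow> (nat \<Rightarrow> real mat) \<Rightarrow> (nat \<Rightarrow> real mat) \<Rightarrow> bool" where
  "r_system G k Z r \<longleftrightarrow> (\<forall>i \<in> followers G.
     r i \<in> carrier_mat (cdim G i) (cdim G 1) \<and>
     r i = - (Hinv G k Z i * (Bmat G k i)\<^sup>T * Z i *
       (Bmat G k 1 + msum (sdim G) (cdim G 1) (\<lambda>j. Bmat G k j * r j) (followers G - {i}))))"

definition W_system :: "aq_game \<Rightarrow> nat \<Rightarrow> (nat \<Rightarrow> real mat) \<Rightarrow> (nat \<Rightarrow> real mat) \<Rightarrow> bool" where
  "W_system G k Z W \<longleftrightarrow> (\<forall>i \<in> followers G.
     W i \<in> carrier_mat (cdim G i) (sdim G) \<and>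
     W i = - (Hinv G k Z i * (Bmat G k i)\<^sup>T * Z i *
       (msum (sdim G) (sdim G) (\<lambda>j. Bmat G k j * W j) (followers G - {i}) + Amat G k)))"

definition w_system ::
  "aq_game \<Rightarrow> nat \<Rightarrow> (nat \<Rightarrow> real mat) \<Rightarrow> (nat \<Rightarrow> real vec) \<Rightarrow> (nat \<Rightarrow> real vec) \<Rightarrow> bool" where
  "w_system G k Z \<zeta> w \<longleftrightarrow> (\<forall>i \<in> followers G.
     w i \<in> carrier_vec (cdim G i) \<and>
     w i = - (Hinv G k Z i *\<^sub>v
       ((Bmat G k i)\<^sup>T *\<^sub>v
          (Z i *\<^sub>v (vsum (sdim G) (\<lambda>j. Bmat G k j *\<^sub>v w j) (followers G - {i}) + svec G k)
           + \<zeta> i - Qmat G k i *\<^sub>v xtgt G k i)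
        - Rmat G k i i *\<^sub>v utgt G k i i)))"

(* In the next two systems the leader's P1 and \<alpha>1 are given; the unknowns are the
   followers' entries of P and \<alpha>. *)

definition P_system ::
  "aq_game \<Rightarrow> nat \<Rightarrow> (nat \<Rightarrow> real mat) \<Rightarrow> real mat \<Rightarrow> (nat \<Rightarrow> real mat) \<Rightarrow> bool" where
  "P_system G k Z P1 P \<longleftrightarrow> (\<forall>i \<in> followers G.
     P i \<in> carrier_mat (cdim G i) (sdim G) \<and>
     P i = Hinv G k Z i * (Bmat G k i)\<^sup>T * Z i *
       (Amat G k - Bmat G k 1 * P1
        - msum (sdim G) (sdim G) (\<lambda>j. Bmat G k j * P j) (followers G - {i})))"

definition alpha_system ::
  "aq_game \<Rightarrow> nat \<Rightarrow> (nat \<Rightarrow> real mat) \<Rightarrow> (nat \<Rightarrow> real vec) \<Rightarrow> real vec \<Rightarrow> (nat \<Rightarrow> real vec) \<Rightarrow> bool" where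
  "alpha_system G k Z \<zeta> \<alpha>1 \<alpha> \<longleftrightarrow> (\<forall>i \<in> followers G.
     \<alpha> i \<in> carrier_vec (cdim G i) \<and>
     \<alpha> i = Hinv G k Z i *\<^sub>v
       ((Bmat G k i)\<^sup>T *\<^sub>v
          (Z i *\<^sub>v (svec G k - Bmat G k 1 *\<^sub>v \<alpha>1
              - vsum (sdim G) (\<lambda>j. Bmat G k j *\<^sub>v \<alpha> j) (followers G - {i}))
           + \<zeta> i - Qmat G k i *\<^sub>v xtgt G k i)
        - Rmat G k i i *\<^sub>v utgt G k i i))"

definition Bbar :: "aq_game \<Rightarrow> nat \<Rightarrow> (nat \<Rightarrow> real mat) \<Rightarrow> real mat" where
  "Bbar G k r =
     Bmat G k 1 + msum (sdim G) (cdim G 1) (\<lambda>j. Bmat G k j * r j) (followers G)"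

definition Delta :: "aq_game \<Rightarrow> nat \<Rightarrow> (nat \<Rightarrow> real mat) \<Rightarrow> (nat \<Rightarrow> real mat) \<Rightarrow> real mat" where
  "Delta G k Z r =
     (Bbar G k r)\<^sup>T * Z 1 * Bbar G k r + Rmat G k 1 1
     + msum (cdim G 1) (cdim G 1) (\<lambda>j. (r j)\<^sup>T * Rmat G k 1 j * r j) (followers G)"

definition leader_P ::
  "aq_game \<Rightarrow> nat \<Rightarrow> (nat \<Rightarrow> real mat) \<Rightarrow> (nat \<Rightarrow> real mat) \<Rightarrow> (nat \<Rightarrow> real mat) \<Rightarrow> real mat" where
  "leader_P G k Z r W =
     minv (Delta G k Z r) *
       ((Bbar G k r)\<^sup>T * Z 1 *
          (Amat G k + msum (sdim G) (sdim G) (\<lambda>j. Bmat G k j * W j) (followers G))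
        + msum (cdim G 1) (sdim G) (\<lambda>j. (r j)\<^sup>T * Rmat G k 1 j * W j) (followers G))"

definition leader_alpha ::
  "aq_game \<Rightarrow> nat \<Rightarrow> (nat \<Rightarrow> real mat) \<Rightarrow> (nat \<Rightarrow> real vec) \<Rightarrow> (nat \<Rightarrow> real mat) \<Rightarrow> (nat \<Rightarrow> real vec) \<Rightarrow> real vec" where
  "leader_alpha G k Z \<zeta> r w =
     minv (Delta G k Z r) *\<^sub>v
       (((Bbar G k r)\<^sup>T * Z 1) *\<^sub>v
          (svec G k + vsum (sdim G) (\<lambda>j. Bmat G k j *\<^sub>v w j) (followers G))
        + vsum (cdim G 1) (\<lambda>j. ((r j)\<^sup>T * Rmat G k 1 j) *\<^sub>v w j) (followers G)
        - Rmat G k 1 1 *\<^sub>v utgt G k 1 1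
        - vsum (cdim G 1) (\<lambda>j. ((r j)\<^sup>T * Rmat G k 1 j) *\<^sub>v utgt G k 1 j) (followers G)
        + (Bbar G k r)\<^sup>T *\<^sub>v (\<zeta> 1 - Qmat G k 1 *\<^sub>v xtgt G k 1))"

definition closed_loop :: "aq_game \<Rightarrow> nat \<Rightarrow> (nat \<Rightarrow> real mat) \<Rightarrow> real mat" where
  "closed_loop G k P =
     Amat G k - msum (sdim G) (sdim G) (\<lambda>j. Bmat G k j * P j) (players G)"

definition sbar :: "aq_game \<Rightarrow> nat \<Rightarrow> (nat \<Rightarrow> real vec) \<Rightarrow> real vec" where
  "sbar G k \<alpha> = svec G k - vsum (sdim G) (\<lambda>j. Bmat G k j *\<^sub>v \<alpha> j) (players G)"

(* The values at stage k - 1 of Z, \<zeta> and n, computed from those at stage k. *)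

definition Z_step ::
  "aq_game \<Rightarrow> nat \<Rightarrow> (nat \<Rightarrow> real mat) \<Rightarrow> (nat \<Rightarrow> real mat) \<Rightarrow> nat \<Rightarrow> real mat" where
  "Z_step G k Z P i =
     (closed_loop G k P)\<^sup>T * Z i * closed_loop G k P
     + msum (sdim G) (sdim G) (\<lambda>j. (P j)\<^sup>T * Rmat G k i j * P j) (players G)
     + Qmat G (k - 1) i"

definition zeta_step ::
  "aq_game \<Rightarrow> nat \<Rightarrow> (nat \<Rightarrow> real mat) \<Rightarrow> (nat \<Rightarrow> real vec) \<Rightarrow> (nat \<Rightarrow> real mat) \<Rightarrow> (nat \<Rightarrow> real vec)
   \<Rightarrow> nat \<Rightarrow> real vec" where
  "zeta_step G k Z \<zeta> P \<alpha> i =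
     (closed_loop G k P)\<^sup>T *\<^sub>v (\<zeta> i + Z i *\<^sub>v sbar G k \<alpha> - Qmat G k i *\<^sub>v xtgt G k i)
     + vsum (sdim G) (\<lambda>j. ((P j)\<^sup>T * Rmat G k i j) *\<^sub>v (\<alpha> j + utgt G k i j)) (players G)"

definition n_step ::
  "aq_game \<Rightarrow> nat \<Rightarrow> (nat \<Rightarrow> real mat) \<Rightarrow> (nat \<Rightarrow> real vec) \<Rightarrow> (nat \<Rightarrow> real) \<Rightarrow> (nat \<Rightarrow> real vec)
   \<Rightarrow> nat \<Rightarrow> real" where
  "n_step G k Z \<zeta> n \<alpha> i =
     n i + 1/2 * (sbar G k \<alpha> \<bullet> (Z i *\<^sub>v sbar G k \<alpha>)) + \<zeta> i \<bullet> sbar G k \<alpha>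
     + 1/2 * (\<Sum>j\<in>players G. \<alpha> j \<bullet> (Rmat G k i j *\<^sub>v \<alpha> j))
     - xtgt G k i \<bullet> (Qmat G k i *\<^sub>v sbar G k \<alpha>)
     + (\<Sum>j\<in>players G. utgt G k i j \<bullet> (Rmat G k i j *\<^sub>v \<alpha> j))
     + 1/2 * (xtgt G k i \<bullet> (Qmat G k i *\<^sub>v xtgt G k i)
              + (\<Sum>j\<in>players G. utgt G k i j \<bullet> (Rmat G k i j *\<^sub>v utgt G k i j)))"

end

theory Submission
  imports Defs "Jordan_Normal_Form.Determinant"
begin

text \<open>
  Write the cost-to-go at stage \<open>k\<close> as a function of the reached state \<open>y\<close> and the controls. With
  continuation values of the stated affine-quadratic form its quadratic part in \<open>y\<close> has the single
  matrix \<open>Z\<close>, so moving the controls by \<open>\<delta>\<close> changes it by an explicit gradient term plus a quadratic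
  form in \<open>\<delta>\<close>. Since \<open>Z\<close> is positive semidefinite and the own
  weights \<open>R\<close> are positive definite, every player's one-variable problem is strictly
  convex and is equivalent to a linear first-order condition. The difference of two solutions of the
  followers' conditions can be added to \<open>w\<close> in the system for \<open>w\<close>, whose unique solvability therefore
  gives unique responses; these are affine, \<open>W x + r u + w\<close>. Substituting them into the leader's cost
  leaves a quadratic with positive definite Hessian \<open>\<Delta>\<close>. Expanding the costs at the resulting controls
  around \<open>x = 0\<close> reproduces the recursion for \<open>Z\<close>, \<open>\<zeta>\<close> and \<open>n\<close>, and backward induction concludes.
\<close>

subsection \<open>Vectors, matrices and quadratic minimization\<close>

text \<open>The distributivity laws of the library are restated with dimension equations as premises, which,
  unlike carrier premises, the simplifier can discharge without guessing a dimension.\<close>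

lemma mult_mat_vec_add:
  fixes A :: "real mat"
  assumes "dim_vec u = dim_col A" "dim_vec v = dim_col A"
  shows "A *\<^sub>v (u + v) = A *\<^sub>v u + A *\<^sub>v v"
  using assms by (intro mult_add_distrib_mat_vec carrier_vecI carrier_matI) auto

lemma mult_mat_vec_minus:
  fixes A :: "real mat"
  assumes "dim_vec u = dim_col A" "dim_vec v = dim_col A"
  shows "A *\<^sub>v (u - v) = A *\<^sub>v u - A *\<^sub>v v"
  using assms by (intro mult_minus_distrib_mat_vec carrier_vecI carrier_matI) auto

lemma mult_mat_vec_uminus:
  fixes A :: "real mat"
  assumes "dim_vec v = dim_col A"
  shows "A *\<^sub>v (- v) = - (A *\<^sub>v v)"
  using assms by (intro eq_vecI) auto

lemma mat_add_mult_vec: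
  fixes A :: "real mat"
  assumes "dim_row B = dim_row A" "dim_col B = dim_col A" "dim_vec v = dim_col A"
  shows "(A + B) *\<^sub>v v = A *\<^sub>v v + B *\<^sub>v v"
  using assms by (intro add_mult_distrib_mat_vec carrier_vecI carrier_matI) auto

lemma mat_minus_mult_vec:
  fixes A :: "real mat"
  assumes "dim_row B = dim_row A" "dim_col B = dim_col A" "dim_vec v = dim_col A"
  shows "(A - B) *\<^sub>v v = A *\<^sub>v v - B *\<^sub>v v"
  using assms by (intro minus_mult_distrib_mat_vec carrier_vecI carrier_matI) auto

lemma mat_mult_mult_vec:
  fixes A :: "real mat"
  assumes "dim_row B = dim_col A" "dim_vec v = dim_col B"
  shows "(A * B) *\<^sub>v v = A *\<^sub>v (B *\<^sub>v v)"
  using assms by (intro assoc_mult_mat_vec carrier_vecI carrier_matI) auto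

lemma scalar_prod_comm:
  fixes u v :: "real vec"
  assumes "dim_vec u = dim_vec v"
  shows "u \<bullet> v = v \<bullet> u"
  using assms by (intro comm_scalar_prod[of _ "dim_vec v"] carrier_vecI) auto

lemma scalar_prod_add_left:
  fixes u v w :: "real vec"
  assumes "dim_vec u = dim_vec w" "dim_vec v = dim_vec w"
  shows "(u + v) \<bullet> w = u \<bullet> w + v \<bullet> w"
  using assms by (intro add_scalar_prod_distrib[of _ "dim_vec w"] carrier_vecI) auto

lemma scalar_prod_add_right:
  fixes u v w :: "real vec"
  assumes "dim_vec u = dim_vec w" "dim_vec v = dim_vec w"
  shows "w \<bullet> (u + v) = w \<bullet> u + w \<bullet> v"
  using assms by (intro scalar_prod_add_distrib[of _ "dim_vec w"] carrier_vecI) auto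

lemma scalar_prod_minus_right:
  fixes u v w :: "real vec"
  assumes "dim_vec u = dim_vec w" "dim_vec v = dim_vec w"
  shows "w \<bullet> (u - v) = w \<bullet> u - w \<bullet> v"
  using assms by (intro scalar_prod_minus_distrib[of _ "dim_vec w"] carrier_vecI) auto

text \<open>Adjointness, oriented so that rewriting removes transposes: a displacement paired with a
  gradient that carries a transposed factor becomes the displaced state paired with a
  costate.\<close>

lemma scalar_prod_transpose_mult:
  fixes A :: "real mat"
  assumes "dim_vec x = dim_col A" "dim_vec y = dim_row A"
  shows "x \<bullet> (A\<^sup>T *\<^sub>v y) = (A *\<^sub>v x) \<bullet> y"
proof -
  have "x \<bullet> (A\<^sup>T *\<^sub>v y) = (A\<^sup>T *\<^sub>v y) \<bullet> x"
    using assms by (intro scalar_prod_comm) auto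
  also have "\<dots> = y \<bullet> (A *\<^sub>v x)"
    using assms by (intro transpose_vec_mult_scalar carrier_vecI carrier_matI) auto
  also have "\<dots> = (A *\<^sub>v x) \<bullet> y"
    using assms by (intro scalar_prod_comm) auto
  finally show ?thesis .
qed

lemma sym_mat_scalar_prod:
  assumes "sym_mat d M" "dim_vec x = d" "dim_vec y = d"
  shows "x \<bullet> (M *\<^sub>v y) = y \<bullet> (M *\<^sub>v x)"
proof -
  have "M \<in> carrier_mat d d" "M\<^sup>T = M" using assms by (auto simp: sym_mat_def)
  then have "x \<bullet> (M *\<^sub>v y) = (M *\<^sub>v x) \<bullet> y"
    using scalar_prod_transpose_mult[of x M y] assms by auto
  also have "\<dots> = y \<bullet> (M *\<^sub>v x)"
    using assms \<open>M \<in> carrier_mat d d\<close> by (intro scalar_prod_comm) auto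
  finally show ?thesis .
qed

section \<open>Finite sums of vectors and matrices\<close>

lemma dim_vsum:
  assumes "\<And>j. j \<in> F \<Longrightarrow> dim_vec (f j) = d"
  shows "dim_vec (vsum d f F) = d"
proof -
  have "f \<in> F \<rightarrow> carrier_vec d" using assms by (auto intro: carrier_vecI)
  then have "vsum d f F \<in> carrier_vec d" by (rule finsum_vec_closed)
  then show ?thesis by auto
qed

text \<open>The bridge from \<open>vsum\<close> to real sums: congruence, linearity and splitting of
  \<open>vsum\<close> are proved entry by entry through it.\<close>

lemma index_vsum:
  assumes "finite F" "\<And>j. j \<in> F \<Longrightarrow> dim_vec (f j) = d" "i < d"
  shows "vsum d f F $ i = (\<Sum>j\<in>F. f j $ i)"
  using assms by (intro index_finsum_vec) (auto intro: carrier_vecI)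

lemma vsum_cong:
  assumes "finite F" "\<And>j. j \<in> F \<Longrightarrow> f j = g j" "\<And>j. j \<in> F \<Longrightarrow> dim_vec (f j) = d"
  shows "vsum d f F = vsum d g F"
  using assms by (intro eq_vecI) (auto simp: dim_vsum index_vsum)

lemma vsum_add:
  assumes "finite F" "\<And>j. j \<in> F \<Longrightarrow> dim_vec (f j) = d" "\<And>j. j \<in> F \<Longrightarrow> dim_vec (g j) = d"
  shows "vsum d (\<lambda>j. f j + g j) F = vsum d f F + vsum d g F"
  using assms by (intro eq_vecI) (auto simp: dim_vsum index_vsum sum.distrib)

lemma vsum_minus:
  assumes "finite F" "\<And>j. j \<in> F \<Longrightarrow> dim_vec (f j) = d" "\<And>j. j \<in> F \<Longrightarrow> dim_vec (g j) = d"
  shows "vsum d (\<lambda>j. f j - g j) F = vsum d f F - vsum d g F"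
  using assms by (intro eq_vecI) (auto simp: dim_vsum index_vsum sum_subtractf)

lemma vsum_uminus:
  assumes "finite F" "\<And>j. j \<in> F \<Longrightarrow> dim_vec (f j) = d"
  shows "vsum d (\<lambda>j. - f j) F = - vsum d f F"
  using assms by (intro eq_vecI) (auto simp: dim_vsum index_vsum sum_negf)

lemma vsum_remove:
  assumes "finite F" "i \<in> F" "\<And>j. j \<in> F \<Longrightarrow> dim_vec (f j) = d"
  shows "vsum d f F = f i + vsum d f (F - {i})"
proof -
  have d: "dim_vec (vsum d f (F - {i})) = d" using assms(3) by (intro dim_vsum) auto
  have "vsum d f (F - {i}) $ l = (\<Sum>j\<in>F - {i}. f j $ l)" if "l < d" for l
    using assms(1,3) that by (intro index_vsum) auto
  then show ?thesis using assms d by (intro eq_vecI) (auto simp: dim_vsum index_vsum sum.remove)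
qed

lemma scalar_prod_vsum:
  assumes "finite F" "\<And>j. j \<in> F \<Longrightarrow> dim_vec (f j) = d" "dim_vec v = d"
  shows "v \<bullet> vsum d f F = (\<Sum>j\<in>F. v \<bullet> f j)"
proof -
  have "v \<bullet> vsum d f F = (\<Sum>i\<in>{0..<d}. \<Sum>j\<in>F. v $ i * f j $ i)"
    unfolding scalar_prod_def using assms
    by (auto simp: dim_vsum index_vsum sum_distrib_left intro!: sum.cong)
  also have "\<dots> = (\<Sum>j\<in>F. \<Sum>i\<in>{0..<d}. v $ i * f j $ i)"
    by (rule sum.swap)
  also have "\<dots> = (\<Sum>j\<in>F. v \<bullet> f j)"
    unfolding scalar_prod_def using assms by (auto intro!: sum.cong)
  finally show ?thesis .
qed

lemma msum_carrier:
  assumes "\<And>j. j \<in> F \<Longrightarrow> f j \<in> carrier_mat nr nc"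
  shows "msum nr nc f F \<in> carrier_mat nr nc"
proof -
  interpret abelian_group "module_mat TYPE(real) nr nc" by (rule abelian_group_mat)
  show ?thesis using finsum_closed[of f F] assms by (auto simp: module_mat_simps)
qed

lemma dim_msum:
  assumes "\<And>j. j \<in> S \<Longrightarrow> dim_row (f j) = nr" "\<And>j. j \<in> S \<Longrightarrow> dim_col (f j) = nc"
  shows "dim_row (msum nr nc f S) = nr" "dim_col (msum nr nc f S) = nc"
  using msum_carrier[of S f nr nc] assms carrier_matI by blast+

text \<open>Matrix sums are only ever evaluated on a vector. This turns each of them into a vector
  sum, so that the matrix systems can be treated like the vector ones.\<close>

lemma msum_mult_vec:
  assumes "finite F" "\<And>j. j \<in> F \<Longrightarrow> f j \<in> carrier_mat nr nc" "dim_vec v = nc"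
  shows "msum nr nc f F *\<^sub>v v = vsum nr (\<lambda>j. f j *\<^sub>v v) F"
  using assms(1,2)
proof (induction F rule: finite_induct)
  interpret abelian_group "module_mat TYPE(real) nr nc" by (rule abelian_group_mat)
  case empty
  have "0\<^sub>m nr nc *\<^sub>v v = 0\<^sub>v nr" using assms(3) by (intro eq_vecI) auto
  then show ?case using finsum_empty[where f = f] by (simp add: finsum_vec_empty module_mat_simps)
next
  interpret abelian_group "module_mat TYPE(real) nr nc" by (rule abelian_group_mat)
  case (insert a F)
  have *: "msum nr nc f (insert a F) = f a + msum nr nc f F"
    using finsum_insert[OF insert(1,2), of f] insert(4) by (auto simp: module_mat_simps)
  have **: "vsum nr (\<lambda>j. f j *\<^sub>v v) (insert a F) = f a *\<^sub>v v + vsum nr (\<lambda>j. f j *\<^sub>v v) F"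
  proof (rule finsum_vec_insert[OF insert(1,2)])
    have v: "v \<in> carrier_vec nc" using assms(3) by (rule carrier_vecI)
    show "(\<lambda>j. f j *\<^sub>v v) \<in> F \<rightarrow> carrier_vec nr"
      using insert(4) v by (auto intro: mult_mat_vec_carrier)
    show "f a *\<^sub>v v \<in> carrier_vec nr"
      using insert(4)[of a] v by (auto intro: mult_mat_vec_carrier)
  qed
  have "msum nr nc f F \<in> carrier_mat nr nc" "f a \<in> carrier_mat nr nc"
    using insert(4) by (auto intro: msum_carrier)
  then have "(f a + msum nr nc f F) *\<^sub>v v = f a *\<^sub>v v + msum nr nc f F *\<^sub>v v"
    using assms(3) by (intro mat_add_mult_vec) auto
  then show ?case unfolding * ** using insert by simp
qed

section \<open>Definite matrices and their inverses\<close>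

lemma pos_def_imp_pos_semidef: "pos_def d M \<Longrightarrow> pos_semidef d M"
proof -
  assume M: "pos_def d M"
  have "0 \<le> x \<bullet> (M *\<^sub>v x)" if "x \<in> carrier_vec d" for x
  proof (cases "x = 0\<^sub>v d")
    case True
    then show ?thesis using M by (auto simp: pos_def_def sym_mat_def)
  next
    case False
    then show ?thesis using M that by (fastforce simp: pos_def_def)
  qed
  then show ?thesis using M by (auto simp: pos_semidef_def pos_def_def)
qed

lemma pos_def_mult_eq_zero:
  assumes "pos_def d M" "v \<in> carrier_vec d" "M *\<^sub>v v = 0\<^sub>v d"
  shows "v = 0\<^sub>v d"
  using assms by (force simp: pos_def_def)

text \<open>A definite matrix has trivial kernel, hence nonzero determinant, so
  \<open>mat_inverse\<close> succeeds. Only then is \<open>minv\<close>, which is defined by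
  \<open>the\<close>, a genuine inverse.\<close>

lemma pos_def_minv:
  assumes "pos_def d M"
  shows "minv M \<in> carrier_mat d d" "M * minv M = 1\<^sub>m d"
proof -
  have M: "M \<in> carrier_mat d d" using assms by (auto simp: pos_def_def sym_mat_def)
  have "det M \<noteq> 0"
    using det_0_iff_vec_prod_zero_field[OF M] pos_def_mult_eq_zero[OF assms] by blast
  then have "M \<in> Units (ring_mat TYPE(real) d ())" by (rule det_non_zero_imp_unit[OF M])
  then obtain B where B: "mat_inverse M = Some B"
    using mat_inverse(1)[OF M, of "()"] by fastforce
  then show "minv M \<in> carrier_mat d d" "M * minv M = 1\<^sub>m d"
    using mat_inverse(2)[OF M B] by (auto simp: minv_def)
qed

lemma pos_def_mult_minv_vec:
  assumes "pos_def d M" "dim_vec c = d"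
  shows "M *\<^sub>v (minv M *\<^sub>v c) = c"
proof -
  have "M \<in> carrier_mat d d" using assms by (auto simp: pos_def_def sym_mat_def)
  then have "M *\<^sub>v (minv M *\<^sub>v c) = (M * minv M) *\<^sub>v c"
    using pos_def_minv[OF assms(1)] assms(2) by (intro mat_mult_mult_vec[symmetric]) auto
  also have "\<dots> = c" using pos_def_minv[OF assms(1)] assms(2) by (auto intro: carrier_vecI)
  finally show ?thesis .
qed

lemma pos_def_mult_inj:
  assumes "pos_def d M" "dim_vec u = d" "dim_vec v = d" "M *\<^sub>v u = M *\<^sub>v v"
  shows "u = v"
proof -
  have M: "M \<in> carrier_mat d d" using assms by (auto simp: pos_def_def sym_mat_def)
  have "M *\<^sub>v (u - v) = M *\<^sub>v u - M *\<^sub>v v" using assms M by (intro mult_mat_vec_minus) auto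
  then have "M *\<^sub>v (u - v) = 0\<^sub>v d" using assms(4) M by auto
  moreover have "u - v \<in> carrier_vec d" using assms(3) by (intro carrier_vecI) simp
  ultimately have *: "u - v = 0\<^sub>v d" using pos_def_mult_eq_zero[OF assms(1)] by blast
  have "u $ i = v $ i" if "i < d" for i
    using arg_cong[OF *, of "\<lambda>z. z $ i"] that assms(3) by simp
  then show ?thesis using assms(2,3) by (intro eq_vecI) simp_all
qed

lemma pos_def_add:
  assumes "pos_def d M" "pos_semidef d N"
  shows "pos_def d (M + N)"
proof -
  have c: "M \<in> carrier_mat d d" "N \<in> carrier_mat d d" "M\<^sup>T = M" "N\<^sup>T = N"
    using assms by (auto simp: pos_def_def pos_semidef_def sym_mat_def)
  have "x \<bullet> ((M + N) *\<^sub>v x) = x \<bullet> (M *\<^sub>v x) + x \<bullet> (N *\<^sub>v x)" if "x \<in> carrier_vec d" for x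
    using c that by (simp add: mat_add_mult_vec scalar_prod_add_right)
  then show ?thesis using assms c
    by (auto simp: pos_def_def pos_semidef_def sym_mat_def add_pos_nonneg transpose_add)
qed

lemma pos_semidef_add:
  assumes "pos_semidef d M" "pos_semidef d N"
  shows "pos_semidef d (M + N)"
proof -
  have c: "M \<in> carrier_mat d d" "N \<in> carrier_mat d d" "M\<^sup>T = M" "N\<^sup>T = N"
    using assms by (auto simp: pos_semidef_def sym_mat_def)
  have "x \<bullet> ((M + N) *\<^sub>v x) = x \<bullet> (M *\<^sub>v x) + x \<bullet> (N *\<^sub>v x)" if "x \<in> carrier_vec d" for x
    using c that by (simp add: mat_add_mult_vec scalar_prod_add_right)
  then show ?thesis using assms c
    by (auto simp: pos_semidef_def sym_mat_def transpose_add)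
qed

text \<open>The form of the product at \<open>x\<close> is the form of \<open>M\<close> at
  \<open>C x\<close>. All Hessians and the recursion for \<open>Z\<close> are built from such
  products.\<close>

lemma pos_semidef_congruence:
  assumes "pos_semidef d M" "C \<in> carrier_mat d e"
  shows "pos_semidef e (C\<^sup>T * M * C)"
proof -
  have c: "M \<in> carrier_mat d d" "M\<^sup>T = M"
    using assms by (auto simp: pos_semidef_def sym_mat_def)
  have "(C\<^sup>T * M * C)\<^sup>T = C\<^sup>T * (C\<^sup>T * M)\<^sup>T"
    using assms c by (intro transpose_mult) auto
  also have "(C\<^sup>T * M)\<^sup>T = M * C"
    using assms c by (subst transpose_mult) auto
  also have "C\<^sup>T * (M * C) = C\<^sup>T * M * C"
    using assms c by (intro assoc_mult_mat[symmetric]) auto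
  finally have t: "(C\<^sup>T * M * C)\<^sup>T = C\<^sup>T * M * C" .
  have "x \<bullet> ((C\<^sup>T * M * C) *\<^sub>v x) = (C *\<^sub>v x) \<bullet> (M *\<^sub>v (C *\<^sub>v x))" if "x \<in> carrier_vec e" for x
    using that c assms by (simp add: mat_mult_mult_vec scalar_prod_transpose_mult)
  then show ?thesis using assms c t by (auto simp: pos_semidef_def sym_mat_def)
qed

lemma zero_mat_mult_vec:
  fixes x :: "real vec"
  assumes "x \<in> carrier_vec nc"
  shows "0\<^sub>m nr nc *\<^sub>v x = 0\<^sub>v nr"
  using assms by (intro eq_vecI) auto

lemma pos_semidef_zero: "pos_semidef d (0\<^sub>m d d)"
  by (auto simp: pos_semidef_def sym_mat_def zero_mat_mult_vec)

lemma pos_semidef_msum: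
  assumes "finite F" "\<And>j. j \<in> F \<Longrightarrow> pos_semidef d (f j)"
  shows "pos_semidef d (msum d d f F)"
  using assms
proof (induction F rule: finite_induct)
  interpret abelian_group "module_mat TYPE(real) d d" by (rule abelian_group_mat)
  case empty
  show ?case using pos_semidef_zero finsum_empty[where f = f] by (simp add: module_mat_simps)
next
  interpret abelian_group "module_mat TYPE(real) d d" by (rule abelian_group_mat)
  case (insert a F)
  have "f j \<in> carrier_mat d d" if "j \<in> insert a F" for j
    using insert(4) that by (auto simp: pos_semidef_def sym_mat_def)
  then have "msum d d f (insert a F) = f a + msum d d f F"
    using finsum_insert[OF insert(1,2), of f] by (auto simp: module_mat_simps)
  then show ?case using insert by (auto intro: pos_semidef_add)
qed

section \<open>Minimizers of quadratic functions\<close>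

lemma scalar_prod_self_nonneg:
  fixes v :: "real vec"
  shows "0 \<le> v \<bullet> v"
  unfolding scalar_prod_def by (intro sum_nonneg) auto

lemma scalar_prod_self_eq_0:
  fixes v :: "real vec"
  assumes "v \<bullet> v = 0" "v \<in> carrier_vec d"
  shows "v = 0\<^sub>v d"
proof -
  have "v $ i * v $ i = 0" if "i \<in> {0..<d}" for i
    using assms that unfolding scalar_prod_def by (subst (asm) sum_nonneg_eq_0_iff) auto
  then show ?thesis using assms by (intro eq_vecI) auto
qed

text \<open>The expansion is exact with the same Hessian \<open>M\<close> at every point. At a zero
  of the gradient only a nonnegative term remains; at any other point a short step against the
  gradient lowers the value.\<close>

lemma is_arg_min_iff_gradient_zero:
  fixes f :: "real vec \<Rightarrow> real"
  assumes M: "pos_semidef d M"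
    and g: "\<And>v. v \<in> carrier_vec d \<Longrightarrow> g v \<in> carrier_vec d"
    and f: "\<And>v h. v \<in> carrier_vec d \<Longrightarrow> h \<in> carrier_vec d \<Longrightarrow>
      f (v + h) = f v + h \<bullet> g v + 1/2 * (h \<bullet> (M *\<^sub>v h))"
  shows "is_arg_min f (\<lambda>v. v \<in> carrier_vec d) v \<longleftrightarrow> v \<in> carrier_vec d \<and> g v = 0\<^sub>v d"
proof
  assume a: "is_arg_min f (\<lambda>v. v \<in> carrier_vec d) v"
  then have v: "v \<in> carrier_vec d" by (simp add: is_arg_min_def)
  have Mc: "M \<in> carrier_mat d d" using M by (auto simp: pos_semidef_def sym_mat_def)
  define c where "c = g v \<bullet> (M *\<^sub>v g v)"
  define e where "e = g v \<bullet> g v"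
  \<comment> \<open>Compare \<open>v\<close> with the point reached by a step of length parameter
    \<open>t\<close> against the gradient.\<close>
  have ineq: "0 \<le> - t * e + 1/2 * t\<^sup>2 * c" for t
  proof -
    have "f v \<le> f (v + (- t) \<cdot>\<^sub>v g v)"
      using a v g[OF v] by (force simp: is_arg_min_def not_less)
    also have "\<dots> = f v + (- t) * e + 1/2 * (t\<^sup>2 * c)"
      using v g[OF v] Mc
      by (subst f) (auto simp: c_def e_def mult_mat_vec[of _ d d] power2_eq_square)
    finally show ?thesis by simp
  qed
  have "c \<ge> 0" using M g[OF v] by (auto simp: pos_semidef_def c_def)
  have "e \<ge> 0" unfolding e_def by (rule scalar_prod_self_nonneg)
  have "e = 0"
  proof (rule ccontr)
    assume "e \<noteq> 0"
    then have "e > 0" using \<open>e \<ge> 0\<close> by simp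
    \<comment> \<open>The parabola in \<open>ineq\<close> is lowest at \<open>e / c\<close>. Adding
      1 keeps the denominator positive when \<open>c = 0\<close> and still gives
      \<open>t * c < e\<close>.\<close>
    define t where "t = e / (c + 1)"
    have t: "t > 0" "t * (c + 1) = e" using \<open>e > 0\<close> \<open>c \<ge> 0\<close> by (auto simp: t_def)
    have "0 \<le> t * (- e + 1/2 * (t * c))" using ineq[of t] by (simp add: algebra_simps power2_eq_square)
    then have "e \<le> 1/2 * (t * c)" using t(1) by (simp add: zero_le_mult_iff)
    moreover have "t * c < e" using t by (simp add: algebra_simps)
    ultimately show False using \<open>e > 0\<close> by simp
  qed
  then have "g v = 0\<^sub>v d"
    using g[OF v] unfolding e_def by (rule scalar_prod_self_eq_0)
  then show "v \<in> carrier_vec d \<and> g v = 0\<^sub>v d" using v by simp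
next
  assume v: "v \<in> carrier_vec d \<and> g v = 0\<^sub>v d"
  have "f v \<le> f y" if y: "y \<in> carrier_vec d" for y
  proof -
    have "f y = f (v + (y - v))" using y v by (intro arg_cong[of _ _ f] eq_vecI) auto
    also have "\<dots> = f v + 1/2 * ((y - v) \<bullet> (M *\<^sub>v (y - v)))"
      using v y by (subst f) auto
    finally show ?thesis using M v y by (auto simp: pos_semidef_def)
  qed
  then show "is_arg_min f (\<lambda>v. v \<in> carrier_vec d) v" using v by (force simp: is_arg_min_def)
qed

lemma quadratic_form_add:
  assumes "sym_mat d M" "dim_vec y = d" "dim_vec h = d"
  shows "(y + h) \<bullet> (M *\<^sub>v (y + h)) = y \<bullet> (M *\<^sub>v y) + 2 * (h \<bullet> (M *\<^sub>v y)) + h \<bullet> (M *\<^sub>v h)"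
proof -
  have "M \<in> carrier_mat d d" using assms by (simp add: sym_mat_def)
  then have M: "dim_row M = d" "dim_col M = d" by auto
  show ?thesis using assms sym_mat_scalar_prod[OF assms]
    by (simp add: M mult_mat_vec_add scalar_prod_add_left scalar_prod_add_right)
qed

text \<open>Symmetry moves the increment into the left factor, so that the gradient is the vector
  paired with \<open>h\<close>.\<close>

lemma affine_form_add:
  assumes "sym_mat d M" "dim_vec y = d" "dim_vec h = d" "dim_vec t = d"
  shows "t \<bullet> (M *\<^sub>v (y + h)) = t \<bullet> (M *\<^sub>v y) + h \<bullet> (M *\<^sub>v t)"
proof -
  have "M \<in> carrier_mat d d" using assms by (simp add: sym_mat_def)
  then have M: "dim_row M = d" "dim_col M = d" by auto
  show ?thesis using assms sym_mat_scalar_prod[of d M t h]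
    by (simp add: M mult_mat_vec_add scalar_prod_add_right)
qed

subsection \<open>One stage: costs and first-order conditions\<close>

lemma finite_players: "finite (players G)"
  by (simp add: players_def)

lemma finite_followers: "finite (followers G)"
  by (simp add: followers_def)

lemma followers_subset_players: "i \<in> followers G \<Longrightarrow> i \<in> players G"
  by (auto simp: followers_def players_def)

lemma leader_notin_followers: "1 \<notin> followers G"
  by (auto simp: followers_def)

text \<open>Profiles are total functions with arbitrary values off \<open>players G\<close>. The
  congruences for state and cost allow replacing a profile by any other that agrees with it on the
  players.\<close>

lemma next_state_cong:
  assumes "\<And>j. j \<in> players G \<Longrightarrow> u j = u' j" "\<And>j. j \<in> players G \<Longrightarrow> dim_row (Bmat G k j) = sdim G"
  shows "next_state G k x u = next_state G k x u'"
proof -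
  have "vsum (sdim G) (\<lambda>j. Bmat G k j *\<^sub>v u j) (players G)
      = vsum (sdim G) (\<lambda>j. Bmat G k j *\<^sub>v u' j) (players G)"
    using assms by (intro vsum_cong finite_players) auto
  then show ?thesis by (simp add: next_state_def)
qed

lemma stage_cost_cong:
  assumes "\<And>j. j \<in> players G \<Longrightarrow> u j = u' j"
  shows "stage_cost G k i y u = stage_cost G k i y u'"
  using assms by (simp add: stage_cost_def)

lemma cost_to_go_cong:
  assumes "\<And>j. j \<in> players G \<Longrightarrow> u j = u' j" "\<And>j. j \<in> players G \<Longrightarrow> dim_row (Bmat G k j) = sdim G"
  shows "cost_to_go G V k i x u = cost_to_go G V k i x u'"
  unfolding cost_to_go_def using next_state_cong[of G u u' k x] stage_cost_cong[of G u u'] assms by simp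

text \<open>\<open>Z\<close> already contains \<open>Q\<close> of the current stage, but the cost of the state reached there is charged
  in the stage cost; hence the difference of quadratic forms in the continuation value.\<close>

locale aq_stage =
  fixes G :: aq_game and k :: nat
    and Z :: "nat \<Rightarrow> real mat" and \<zeta> :: "nat \<Rightarrow> real vec" and c :: "nat \<Rightarrow> real"
    and V :: "nat \<Rightarrow> nat \<Rightarrow> real vec \<Rightarrow> real"
  assumes game: "affine_quadratic_game G"
    and stage: "k \<in> stages G"
    and definiteness: "\<And>i. i \<in> players G \<Longrightarrow>
        pos_semidef (sdim G) (Qmat G k i) \<and> pos_def (cdim G i) (Rmat G k i i) \<and>
        (\<forall>j \<in> players G - {i}. pos_semidef (cdim G j) (Rmat G k i j))"
    and Z_psd: "\<And>i. i \<in> players G \<Longrightarrow> pos_semidef (sdim G) (Z i)"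
    and zeta_carrier: "\<And>i. i \<in> players G \<Longrightarrow> \<zeta> i \<in> carrier_vec (sdim G)"
    and V_next: "\<And>i x. i \<in> players G \<Longrightarrow> x \<in> carrier_vec (sdim G) \<Longrightarrow>
        V i (k + 1) x = 1/2 * (x \<bullet> (Z i *\<^sub>v x) - x \<bullet> (Qmat G k i *\<^sub>v x)) + \<zeta> i \<bullet> x + c i"
begin

text \<open>Otherwise the leader's index 1 would be rewritten to \<open>Suc 0\<close> and the
  simplification rules stated for player 1 would no longer match.\<close>

declare One_nat_def [simp del]

abbreviation "A \<equiv> Amat G k"
abbreviation "B \<equiv> Bmat G k"
abbreviation "s \<equiv> svec G k"
abbreviation "Q \<equiv> Qmat G k"
abbreviation "R \<equiv> Rmat G k"
abbreviation "xt \<equiv> xtgt G k"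
abbreviation "ut \<equiv> utgt G k"
abbreviation "d \<equiv> sdim G"
abbreviation "N \<equiv> players G"
abbreviation "F \<equiv> followers G"

lemma one_in_N [simp]: "1 \<in> N"
  using game by (auto simp: affine_quadratic_game_def players_def)

lemma N_eq: "N = insert 1 F"
  using one_in_N by (auto simp: players_def followers_def)

lemmas [simp] = finite_players finite_followers followers_subset_players leader_notin_followers

lemma follower_ne_leader [simp]: "i \<in> F \<Longrightarrow> i \<noteq> 1"
  by (auto simp: followers_def)

lemma sum_N: "(\<Sum>j\<in>N. f j) = f 1 + (\<Sum>j\<in>F. f j)"
  unfolding N_eq by (subst sum.insert) auto

lemma vsum_N:
  assumes "\<And>j. j \<in> N \<Longrightarrow> dim_vec (f j) = e"
  shows "vsum e f N = f 1 + vsum e f F"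
proof -
  have "N - {1} = F" by (auto simp: players_def followers_def)
  then show ?thesis using vsum_remove[of N 1 f e] assms by simp
qed

lemma B_carrier: "j \<in> N \<Longrightarrow> B j \<in> carrier_mat d (cdim G j)"
  and Q_carrier: "j \<in> N \<Longrightarrow> Q j \<in> carrier_mat d d"
  and R_carrier: "i \<in> N \<Longrightarrow> j \<in> N \<Longrightarrow> R i j \<in> carrier_mat (cdim G j) (cdim G j)"
  and Z_carrier: "j \<in> N \<Longrightarrow> Z j \<in> carrier_mat d d"
  using game stage Z_psd unfolding affine_quadratic_game_def sym_mat_def pos_semidef_def by blast+

lemma dims [simp]:
  "dim_row A = d" "dim_col A = d" "dim_vec s = d"
  "j \<in> N \<Longrightarrow> dim_row (B j) = d" "j \<in> N \<Longrightarrow> dim_col (B j) = cdim G j"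
  "j \<in> N \<Longrightarrow> dim_row (Q j) = d" "j \<in> N \<Longrightarrow> dim_col (Q j) = d"
  "j \<in> N \<Longrightarrow> dim_vec (xt j) = d"
  "j \<in> N \<Longrightarrow> dim_row (Z j) = d" "j \<in> N \<Longrightarrow> dim_col (Z j) = d"
  "j \<in> N \<Longrightarrow> dim_vec (\<zeta> j) = d"
  using game stage zeta_carrier[of j] B_carrier[of j] Q_carrier[of j] Z_carrier[of j]
  by (auto simp: affine_quadratic_game_def)

lemma dims_R [simp]:
  assumes "i \<in> N" "j \<in> N"
  shows "dim_row (R i j) = cdim G j" "dim_col (R i j) = cdim G j" "dim_vec (ut i j) = cdim G j"
  using game stage assms by (auto simp: affine_quadratic_game_def sym_mat_def)

lemma sym_data [simp]:
  "i \<in> N \<Longrightarrow> sym_mat d (Q i)" "i \<in> N \<Longrightarrow> sym_mat d (Z i)"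
  "i \<in> N \<Longrightarrow> j \<in> N \<Longrightarrow> sym_mat (cdim G j) (R i j)"
  using game stage Z_psd by (auto simp: affine_quadratic_game_def pos_semidef_def)

lemma R_psd: "i \<in> N \<Longrightarrow> j \<in> N \<Longrightarrow> pos_semidef (cdim G j) (R i j)"
  using definiteness[of i] pos_def_imp_pos_semidef by (cases "i = j") auto

lemma R_pd: "i \<in> N \<Longrightarrow> pos_def (cdim G i) (R i i)"
  using definiteness[of i] by auto

section \<open>Exact expansion of the cost-to-go\<close>

lemma dim_next_state [simp]: "dim_vec (next_state G k x u) = d"
  by (simp add: next_state_def)

text \<open>The gradient of \<open>objective\<close> in the reached state: the stage weight
  \<open>Q\<close> and the continuation weight \<open>Z - Q\<close> add up to
  \<open>Z\<close>.\<close>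

definition costate :: "nat \<Rightarrow> real vec \<Rightarrow> real vec" where
  "costate i y = Z i *\<^sub>v y + \<zeta> i - Q i *\<^sub>v xt i"

lemma dim_costate [simp]: "i \<in> N \<Longrightarrow> dim_vec (costate i y) = d"
  by (simp add: costate_def)

text \<open>State and controls are independent arguments, so that the cost can be expanded before
  the dynamics ties them together.\<close>

definition objective :: "nat \<Rightarrow> real vec \<Rightarrow> (nat \<Rightarrow> real vec) \<Rightarrow> real" where
  "objective i y u = stage_cost G k i y u + 1/2 * (y \<bullet> (Z i *\<^sub>v y) - y \<bullet> (Q i *\<^sub>v y)) + \<zeta> i \<bullet> y + c i"

lemma cost_to_go_eq_objective: "i \<in> N \<Longrightarrow> cost_to_go G V k i x u = objective i (next_state G k x u) u"
  using V_next[of i "next_state G k x u"] by (simp add: cost_to_go_def objective_def carrier_vecI)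

text \<open>The forms in \<open>Q\<close> from the stage cost and from the continuation value
  cancel, which leaves \<open>Z\<close> as the only quadratic weight on the state.\<close>

lemma objective_add:
  assumes i: "i \<in> N" and y: "dim_vec y = d" "dim_vec h = d"
    and u: "\<And>j. j \<in> N \<Longrightarrow> dim_vec (u j) = cdim G j" "\<And>j. j \<in> N \<Longrightarrow> dim_vec (\<delta> j) = cdim G j"
  shows "objective i (y + h) (\<lambda>j. u j + \<delta> j) = objective i y u + h \<bullet> costate i y + 1/2 * (h \<bullet> (Z i *\<^sub>v h))
     + (\<Sum>j\<in>N. \<delta> j \<bullet> (R i j *\<^sub>v (u j - ut i j))) + 1/2 * (\<Sum>j\<in>N. \<delta> j \<bullet> (R i j *\<^sub>v \<delta> j))"
proof -
  have 1: "(\<Sum>j\<in>N. (u j + \<delta> j) \<bullet> (R i j *\<^sub>v (u j + \<delta> j))) =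
     (\<Sum>j\<in>N. u j \<bullet> (R i j *\<^sub>v u j)) + 2 * (\<Sum>j\<in>N. \<delta> j \<bullet> (R i j *\<^sub>v u j)) + (\<Sum>j\<in>N. \<delta> j \<bullet> (R i j *\<^sub>v \<delta> j))"
    unfolding sum_distrib_left sum.distrib[symmetric] using i u
    by (intro sum.cong refl quadratic_form_add) auto
  have 2: "(\<Sum>j\<in>N. ut i j \<bullet> (R i j *\<^sub>v (u j + \<delta> j))) =
     (\<Sum>j\<in>N. ut i j \<bullet> (R i j *\<^sub>v u j)) + (\<Sum>j\<in>N. \<delta> j \<bullet> (R i j *\<^sub>v ut i j))"
    unfolding sum.distrib[symmetric] using i u
    by (intro sum.cong refl affine_form_add) auto
  have 3: "(\<Sum>j\<in>N. \<delta> j \<bullet> (R i j *\<^sub>v (u j - ut i j))) =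
     (\<Sum>j\<in>N. \<delta> j \<bullet> (R i j *\<^sub>v u j)) - (\<Sum>j\<in>N. \<delta> j \<bullet> (R i j *\<^sub>v ut i j))"
    unfolding sum_subtractf[symmetric] using i u
    by (intro sum.cong refl) (simp add: mult_mat_vec_minus scalar_prod_minus_right)
  have 4: "h \<bullet> costate i y = h \<bullet> (Z i *\<^sub>v y) + h \<bullet> \<zeta> i - h \<bullet> (Q i *\<^sub>v xt i)"
    using i y by (simp add: costate_def scalar_prod_minus_right scalar_prod_add_right)
  have 5: "\<zeta> i \<bullet> (y + h) = \<zeta> i \<bullet> y + h \<bullet> \<zeta> i"
    using i y scalar_prod_comm[of h "\<zeta> i"] by (simp add: scalar_prod_add_right)
  show ?thesis
    unfolding objective_def stage_cost_def 1 2 3 4 5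
    using quadratic_form_add[of d "Q i" y h] quadratic_form_add[of d "Z i" y h]
      affine_form_add[of d "Q i" y h "xt i"] i y
    by (simp add: algebra_simps add_divide_distrib)
qed

lemma next_state_add:
  assumes "\<And>j. j \<in> N \<Longrightarrow> dim_vec (u j) = cdim G j" "\<And>j. j \<in> N \<Longrightarrow> dim_vec (\<delta> j) = cdim G j"
  shows "next_state G k x (\<lambda>j. u j + \<delta> j) = next_state G k x u + vsum d (\<lambda>j. B j *\<^sub>v \<delta> j) N"
proof -
  have "vsum d (\<lambda>j. B j *\<^sub>v (u j + \<delta> j)) N = vsum d (\<lambda>j. B j *\<^sub>v u j + B j *\<^sub>v \<delta> j) N"
    using assms by (intro vsum_cong) (auto simp: mult_mat_vec_add)
  also have "\<dots> = vsum d (\<lambda>j. B j *\<^sub>v u j) N + vsum d (\<lambda>j. B j *\<^sub>v \<delta> j) N"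
    using assms by (intro vsum_add) auto
  finally show ?thesis
    unfolding next_state_def by (intro eq_vecI) (auto simp del: index_mult_mat_vec simp: dim_vsum)
qed

text \<open>The perturbation formula behind both optimization problems. A follower moves one
  component; the leader moves every component through the reactions. The displacement of the state
  is a separate variable \<open>h\<close> so that a simplified form of it can be supplied.\<close>

lemma cost_to_go_add:
  assumes i: "i \<in> N"
    and u: "\<And>j. j \<in> N \<Longrightarrow> dim_vec (u j) = cdim G j" "\<And>j. j \<in> N \<Longrightarrow> dim_vec (\<delta> j) = cdim G j"
    and u': "\<And>j. j \<in> N \<Longrightarrow> u' j = u j + \<delta> j"
    and h: "vsum d (\<lambda>j. B j *\<^sub>v \<delta> j) N = h"
  shows "cost_to_go G V k i x u' = cost_to_go G V k i x u
     + h \<bullet> costate i (next_state G k x u) + 1/2 * (h \<bullet> (Z i *\<^sub>v h))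
     + (\<Sum>j\<in>N. \<delta> j \<bullet> (R i j *\<^sub>v (u j - ut i j))) + 1/2 * (\<Sum>j\<in>N. \<delta> j \<bullet> (R i j *\<^sub>v \<delta> j))"
proof -
  have "dim_vec h = d" unfolding h[symmetric] by (intro dim_vsum) auto
  moreover have "cost_to_go G V k i x u' = cost_to_go G V k i x (\<lambda>j. u j + \<delta> j)"
    using u' by (intro cost_to_go_cong) auto
  ultimately show ?thesis
    using cost_to_go_eq_objective[OF i] objective_add[OF i, of "next_state G k x u" h u \<delta>] next_state_add[of u \<delta> x] u h
    by simp
qed

text \<open>The gradient of a player's cost-to-go in the own control, and its linear part.\<close>

definition foc :: "nat \<Rightarrow> real vec \<Rightarrow> real vec \<Rightarrow> real vec" where
  "foc i y v = (B i)\<^sup>T *\<^sub>v costate i y + R i i *\<^sub>v (v - ut i i)"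

definition foc_linear :: "nat \<Rightarrow> real vec \<Rightarrow> real vec \<Rightarrow> real vec" where
  "foc_linear i y v = (B i)\<^sup>T *\<^sub>v (Z i *\<^sub>v y) + R i i *\<^sub>v v"

text \<open>The matrix inverted in \<open>Hinv\<close>. For a follower it is the second derivative
  of the cost-to-go in the own control.\<close>

definition hessian :: "nat \<Rightarrow> real mat" where
  "hessian i = R i i + (B i)\<^sup>T * Z i * B i"

lemma hessian_pd: "i \<in> N \<Longrightarrow> pos_def (cdim G i) (hessian i)"
  unfolding hessian_def by (intro pos_def_add R_pd pos_semidef_congruence[OF Z_psd B_carrier])

lemma dim_hessian [simp]: "i \<in> N \<Longrightarrow> dim_row (hessian i) = cdim G i" "i \<in> N \<Longrightarrow> dim_col (hessian i) = cdim G i"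
  using hessian_pd[of i] by (auto simp: pos_def_def sym_mat_def)

lemma hessian_mult_vec:
  "i \<in> N \<Longrightarrow> dim_vec v = cdim G i \<Longrightarrow> hessian i *\<^sub>v v = R i i *\<^sub>v v + (B i)\<^sup>T *\<^sub>v (Z i *\<^sub>v (B i *\<^sub>v v))"
  by (simp add: hessian_def mat_add_mult_vec mat_mult_mult_vec)

lemma dim_Hinv [simp]:
  assumes "i \<in> N"
  shows "dim_row (Hinv G k Z i) = cdim G i" "dim_col (Hinv G k Z i) = cdim G i"
  using pos_def_minv(1)[OF hessian_pd[OF assms]] by (auto simp: Hinv_def hessian_def)

lemma hessian_mult_Hinv: "i \<in> N \<Longrightarrow> dim_vec v = cdim G i \<Longrightarrow> hessian i *\<^sub>v (Hinv G k Z i *\<^sub>v v) = v"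
  using pos_def_mult_minv_vec[OF hessian_pd[of i], of v] by (simp add: Hinv_def hessian_def)

text \<open>Multiplying by the invertible Hessian is reversible, so the explicit formulas of the
  systems are equivalent to linear equations.\<close>

lemma eq_uminus_Hinv_iff:
  assumes "i \<in> N" "dim_vec v = cdim G i" "dim_vec b = cdim G i"
  shows "v = - (Hinv G k Z i *\<^sub>v b) \<longleftrightarrow> hessian i *\<^sub>v v + b = 0\<^sub>v (cdim G i)"
proof -
  have *: "hessian i *\<^sub>v (- (Hinv G k Z i *\<^sub>v b)) = - b"
    using assms by (simp add: mult_mat_vec_uminus hessian_mult_Hinv)
  have "v = - (Hinv G k Z i *\<^sub>v b) \<longleftrightarrow> hessian i *\<^sub>v v = - b"
    using * pos_def_mult_inj[OF hessian_pd[OF assms(1)], of v "- (Hinv G k Z i *\<^sub>v b)"] assms by auto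
  also have "\<dots> \<longleftrightarrow> hessian i *\<^sub>v v + b = 0\<^sub>v (cdim G i)"
  proof
    assume "hessian i *\<^sub>v v = - b"
    then show "hessian i *\<^sub>v v + b = 0\<^sub>v (cdim G i)" using assms by (intro eq_vecI) auto
  next
    assume a: "hessian i *\<^sub>v v + b = 0\<^sub>v (cdim G i)"
    show "hessian i *\<^sub>v v = - b"
    proof (rule eq_vecI)
      fix l assume "l < dim_vec (- b)"
      then show "(hessian i *\<^sub>v v) $ l = (- b) $ l"
        using arg_cong[OF a, of "\<lambda>z. z $ l"] assms by (simp del: index_mult_mat_vec)
    qed (use assms in simp)
  qed
  finally show ?thesis .
qed

text \<open>Splitting the own contribution \<open>B i v\<close> off the state collects all
  dependence on \<open>v\<close> in the Hessian, as \<open>eq_uminus_Hinv_iff\<close>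
  requires.\<close>

lemma foc_linear_eq:
  assumes "i \<in> N" "dim_vec y = d" "dim_vec v = cdim G i"
  shows "foc_linear i (B i *\<^sub>v v + y) v = hessian i *\<^sub>v v + (B i)\<^sup>T *\<^sub>v (Z i *\<^sub>v y)"
  using assms unfolding foc_linear_def
  by (intro eq_vecI) (auto simp: hessian_mult_vec mult_mat_vec_add simp del: index_mult_mat_vec)

lemma foc_eq:
  assumes "i \<in> N" "dim_vec y = d" "dim_vec v = cdim G i"
  shows "foc i (B i *\<^sub>v v + y) v = hessian i *\<^sub>v v + ((B i)\<^sup>T *\<^sub>v costate i y - R i i *\<^sub>v ut i i)"
  using assms unfolding foc_def costate_def
  by (intro eq_vecI) (auto simp: hessian_mult_vec mult_mat_vec_add mult_mat_vec_minus simp del: index_mult_mat_vec)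

text \<open>The basis for superposition: adding a solution of the homogeneous condition to a
  solution of the inhomogeneous one gives a solution again.\<close>

lemma foc_add:
  assumes "i \<in> N" "dim_vec y = d" "dim_vec h = d" "dim_vec v = cdim G i" "dim_vec e = cdim G i"
  shows "foc i (y + h) (v + e) = foc i y v + foc_linear i h e"
  using assms unfolding foc_def costate_def foc_linear_def
  by (intro eq_vecI) (auto simp: mult_mat_vec_add mult_mat_vec_minus simp del: index_mult_mat_vec)

lemma dim_foc [simp]: "i \<in> N \<Longrightarrow> dim_vec (foc i y v) = cdim G i"
  by (simp add: foc_def)

lemma dim_foc_linear [simp]: "i \<in> N \<Longrightarrow> dim_vec (foc_linear i y v) = cdim G i"
  by (simp add: foc_linear_def)

section \<open>The stage systems as first-order conditions\<close>

lemma vsum_F_remove: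
  assumes "i \<in> F"
  shows "vsum d (\<lambda>j. B j *\<^sub>v v j) F = B i *\<^sub>v v i + vsum d (\<lambda>j. B j *\<^sub>v v j) (F - {i})"
  using assms by (intro vsum_remove) auto

lemma dim_vsum_B [simp]:
  "S \<subseteq> N \<Longrightarrow> dim_vec (vsum d (\<lambda>j. B j *\<^sub>v v j) S) = d"
  by (intro dim_vsum) auto

lemma F_subset_N [simp]: "F \<subseteq> N" "F - S \<subseteq> N"
  by auto

text \<open>The system for \<open>w\<close> consists of the followers' first-order conditions at
  state 0 when the leader plays 0.\<close>

lemma w_system_iff:
  "w_system G k Z \<zeta> w \<longleftrightarrow> (\<forall>i\<in>F. w i \<in> carrier_vec (cdim G i) \<and>
     foc i (vsum d (\<lambda>j. B j *\<^sub>v w j) F + s) (w i) = 0\<^sub>v (cdim G i))"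
proof -
  have "(w i = - (Hinv G k Z i *\<^sub>v
       ((B i)\<^sup>T *\<^sub>v (Z i *\<^sub>v (vsum d (\<lambda>j. B j *\<^sub>v w j) (F - {i}) + s) + \<zeta> i - Q i *\<^sub>v xt i)
        - R i i *\<^sub>v ut i i)))
     \<longleftrightarrow> foc i (vsum d (\<lambda>j. B j *\<^sub>v w j) F + s) (w i) = 0\<^sub>v (cdim G i)"
    if i: "i \<in> F" and w: "w i \<in> carrier_vec (cdim G i)" for i
  proof -
    have "vsum d (\<lambda>j. B j *\<^sub>v w j) F + s = B i *\<^sub>v w i + (vsum d (\<lambda>j. B j *\<^sub>v w j) (F - {i}) + s)"
      unfolding vsum_F_remove[OF i] using i by (intro eq_vecI) (auto simp del: index_mult_mat_vec)
    then show ?thesis using i w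
      by (subst eq_uminus_Hinv_iff) (auto simp: foc_eq costate_def)
  qed
  then show ?thesis unfolding w_system_def by blast
qed

text \<open>The common shape of the systems for \<open>r\<close> and \<open>W\<close>, evaluated on
  a vector. The forcing term \<open>a\<close> is the leader's contribution \<open>B 1 u\<close> in
  the first case and the drift \<open>A x\<close> in the second.\<close>

lemma foc_linear_solution:
  assumes i: "i \<in> F" and v: "\<And>j. j \<in> F \<Longrightarrow> dim_vec (v j) = cdim G j" and a: "dim_vec a = d"
    and eq: "v i = - (Hinv G k Z i *\<^sub>v ((B i)\<^sup>T *\<^sub>v (Z i *\<^sub>v (a + vsum d (\<lambda>j. B j *\<^sub>v v j) (F - {i})))))"
  shows "foc_linear i (a + vsum d (\<lambda>j. B j *\<^sub>v v j) F) (v i) = 0\<^sub>v (cdim G i)"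
proof -
  have "a + vsum d (\<lambda>j. B j *\<^sub>v v j) F = B i *\<^sub>v v i + (a + vsum d (\<lambda>j. B j *\<^sub>v v j) (F - {i}))"
    unfolding vsum_F_remove[OF i] using i a by (intro eq_vecI) (auto simp del: index_mult_mat_vec)
  moreover have "hessian i *\<^sub>v v i + (B i)\<^sup>T *\<^sub>v (Z i *\<^sub>v (a + vsum d (\<lambda>j. B j *\<^sub>v v j) (F - {i}))) = 0\<^sub>v (cdim G i)"
    using i v eq by (subst eq_uminus_Hinv_iff[symmetric]) auto
  ultimately show ?thesis using i v a by (simp add: foc_linear_eq)
qed

end

subsection \<open>Reactions of the followers\<close>

locale aq_stage_solution = aq_stage +
  fixes r W P :: "nat \<Rightarrow> real mat" and w \<alpha> :: "nat \<Rightarrow> real vec"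
  assumes r_sys: "r_system G k Z r"
    and W_sys: "W_system G k Z W"
    and w_unique: "unique_solution_on (followers G) (w_system G k Z \<zeta>) w"
    and leader: "P 1 = leader_P G k Z r W" "\<alpha> 1 = leader_alpha G k Z \<zeta> r w"
    and chain: "\<And>i. i \<in> followers G \<Longrightarrow> P i = - W i + r i * P 1"
      "\<And>i. i \<in> followers G \<Longrightarrow> \<alpha> i = - w i + r i *\<^sub>v \<alpha> 1"
begin

declare One_nat_def [simp del]

lemma w_sys: "w_system G k Z \<zeta> w"
  using w_unique by (simp add: unique_solution_on_def)

lemma dims_sol [simp]:
  assumes "i \<in> F"
  shows "dim_row (r i) = cdim G i" "dim_col (r i) = cdim G 1"
    "dim_row (W i) = cdim G i" "dim_col (W i) = d" "dim_vec (w i) = cdim G i"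
proof -
  have "r i \<in> carrier_mat (cdim G i) (cdim G 1)" "W i \<in> carrier_mat (cdim G i) d"
    "w i \<in> carrier_vec (cdim G i)"
    using assms r_sys W_sys w_sys unfolding r_system_def W_system_def w_system_def by blast+
  then show "dim_row (r i) = cdim G i" "dim_col (r i) = cdim G 1"
    "dim_row (W i) = cdim G i" "dim_col (W i) = d" "dim_vec (w i) = cdim G i" by auto
qed

lemma msum_B_mult_vec:
  assumes "S \<subseteq> F" "\<And>j. j \<in> F \<Longrightarrow> dim_row (M j) = cdim G j" "\<And>j. j \<in> F \<Longrightarrow> dim_col (M j) = dim_vec v"
  shows "msum d (dim_vec v) (\<lambda>j. B j * M j) S *\<^sub>v v = vsum d (\<lambda>j. B j *\<^sub>v (M j *\<^sub>v v)) S"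
proof -
  have "finite S" using assms(1) finite_subset[of S F] by simp
  have "msum d (dim_vec v) (\<lambda>j. B j * M j) S *\<^sub>v v = vsum d (\<lambda>j. (B j * M j) *\<^sub>v v) S"
    using assms \<open>finite S\<close> by (intro msum_mult_vec carrier_matI) auto
  also have "\<dots> = vsum d (\<lambda>j. B j *\<^sub>v (M j *\<^sub>v v)) S"
    using assms \<open>finite S\<close>
    by (intro vsum_cong) (auto simp: mat_mult_mult_vec subset_iff)
  finally show ?thesis .
qed

lemma dim_msum_B [simp]:
  assumes "S \<subseteq> F" "\<And>j. j \<in> F \<Longrightarrow> dim_col (M j) = e"
  shows "dim_row (msum d e (\<lambda>j. B j * M j) S) = d" "dim_col (msum d e (\<lambda>j. B j * M j) S) = e"
  using assms by (intro dim_msum; auto simp: subset_iff)+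

text \<open>The moves \<open>r j u\<close> are the followers' joint linear reply to a move
  \<open>u\<close> of the leader; \<open>W_foc\<close> is the analogue for a change of the
  state.\<close>

lemma r_foc:
  assumes i: "i \<in> F" and u: "dim_vec u = cdim G 1"
  shows "foc_linear i (B 1 *\<^sub>v u + vsum d (\<lambda>j. B j *\<^sub>v (r j *\<^sub>v u)) F) (r i *\<^sub>v u) = 0\<^sub>v (cdim G i)"
proof (rule foc_linear_solution[OF i])
  let ?m = "msum d (cdim G 1) (\<lambda>j. B j * r j) (F - {i})"
  have e: "r i = - (Hinv G k Z i * (B i)\<^sup>T * Z i * (B 1 + ?m))"
    using r_sys i by (simp add: r_system_def)
  have m: "?m *\<^sub>v u = vsum d (\<lambda>j. B j *\<^sub>v (r j *\<^sub>v u)) (F - {i})"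
    using msum_B_mult_vec[of "F - {i}" r u] u by auto
  have dm: "dim_row ?m = d" "dim_col ?m = cdim G 1" by auto
  have "r i *\<^sub>v u = - (Hinv G k Z i * (B i)\<^sup>T * Z i * (B 1 + ?m)) *\<^sub>v u"
    using arg_cong[OF e, of "\<lambda>M. M *\<^sub>v u"] .
  also have "\<dots> = - (Hinv G k Z i *\<^sub>v ((B i)\<^sup>T *\<^sub>v (Z i *\<^sub>v (B 1 *\<^sub>v u + ?m *\<^sub>v u))))"
    using i u by (simp add: mat_mult_mult_vec mat_add_mult_vec dm)
  finally show "r i *\<^sub>v u = - (Hinv G k Z i *\<^sub>v ((B i)\<^sup>T *\<^sub>v (Z i *\<^sub>v
      (B 1 *\<^sub>v u + vsum d (\<lambda>j. B j *\<^sub>v (r j *\<^sub>v u)) (F - {i})))))"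
    unfolding m .
qed (auto simp: u)

lemma W_foc:
  assumes i: "i \<in> F" and x: "dim_vec x = d"
  shows "foc_linear i (A *\<^sub>v x + vsum d (\<lambda>j. B j *\<^sub>v (W j *\<^sub>v x)) F) (W i *\<^sub>v x) = 0\<^sub>v (cdim G i)"
proof (rule foc_linear_solution[OF i])
  let ?m = "msum d d (\<lambda>j. B j * W j) (F - {i})"
  have e: "W i = - (Hinv G k Z i * (B i)\<^sup>T * Z i * (?m + A))"
    using W_sys i by (simp add: W_system_def)
  have m: "?m *\<^sub>v x = vsum d (\<lambda>j. B j *\<^sub>v (W j *\<^sub>v x)) (F - {i})"
    using msum_B_mult_vec[of "F - {i}" W x] x by auto
  have dm: "dim_row ?m = d" "dim_col ?m = d" by auto
  have "W i *\<^sub>v x = - (Hinv G k Z i * (B i)\<^sup>T * Z i * (?m + A)) *\<^sub>v x"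
    using arg_cong[OF e, of "\<lambda>M. M *\<^sub>v x"] .
  also have "\<dots> = - (Hinv G k Z i *\<^sub>v ((B i)\<^sup>T *\<^sub>v (Z i *\<^sub>v (?m *\<^sub>v x + A *\<^sub>v x))))"
    using i x by (simp add: mat_mult_mult_vec mat_add_mult_vec dm)
  also have "?m *\<^sub>v x + A *\<^sub>v x = A *\<^sub>v x + ?m *\<^sub>v x"
    using dm by (intro comm_add_vec[of _ d] carrier_vecI) auto
  finally show "W i *\<^sub>v x = - (Hinv G k Z i *\<^sub>v ((B i)\<^sup>T *\<^sub>v (Z i *\<^sub>v
      (A *\<^sub>v x + vsum d (\<lambda>j. B j *\<^sub>v (W j *\<^sub>v x)) (F - {i})))))"
    unfolding m .
qed (auto simp: x)

text \<open>The restriction to the followers makes this an element of the \<open>PiE\<close> set in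
  \<open>follower_response\<close>, where tuples are equal exactly as functions.\<close>

definition resp :: "real vec \<Rightarrow> real vec \<Rightarrow> nat \<Rightarrow> real vec" where
  "resp x u = (\<lambda>i\<in>F. W i *\<^sub>v x + r i *\<^sub>v u + w i)"

lemma dim_resp [simp]: "i \<in> F \<Longrightarrow> dim_vec (resp x u i) = cdim G i"
  by (simp add: resp_def)

lemma next_state_eq:
  assumes "\<And>j. j \<in> F \<Longrightarrow> dim_vec (v j) = cdim G j" "dim_vec u = cdim G 1"
  shows "next_state G k x (v(1 := u)) = A *\<^sub>v x + B 1 *\<^sub>v u + vsum d (\<lambda>j. B j *\<^sub>v v j) F + s"
proof -
  have "vsum d (\<lambda>j. B j *\<^sub>v (v(1 := u)) j) N = B 1 *\<^sub>v u + vsum d (\<lambda>j. B j *\<^sub>v (v(1 := u)) j) F"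
    by (subst vsum_N) auto
  also have "vsum d (\<lambda>j. B j *\<^sub>v (v(1 := u)) j) F = vsum d (\<lambda>j. B j *\<^sub>v v j) F"
    by (intro vsum_cong) auto
  finally show ?thesis unfolding next_state_def
    by (intro eq_vecI) (auto simp del: index_mult_mat_vec)
qed

text \<open>The reached state is grouped into the three summands that belong to \<open>w\<close>,
  \<open>W\<close> and \<open>r\<close>, in the order in which \<open>foc_add\<close> peels them
  off.\<close>

lemma next_state_resp:
  assumes "dim_vec x = d" "dim_vec u = cdim G 1"
  shows "next_state G k x ((resp x u)(1 := u)) =
    vsum d (\<lambda>j. B j *\<^sub>v w j) F + s
    + (A *\<^sub>v x + vsum d (\<lambda>j. B j *\<^sub>v (W j *\<^sub>v x)) F)
    + (B 1 *\<^sub>v u + vsum d (\<lambda>j. B j *\<^sub>v (r j *\<^sub>v u)) F)"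
proof -
  have "vsum d (\<lambda>j. B j *\<^sub>v resp x u j) F
    = vsum d (\<lambda>j. B j *\<^sub>v (W j *\<^sub>v x) + B j *\<^sub>v (r j *\<^sub>v u) + B j *\<^sub>v w j) F"
    using assms by (intro vsum_cong) (auto simp: resp_def mult_mat_vec_add)
  also have "\<dots> = vsum d (\<lambda>j. B j *\<^sub>v (W j *\<^sub>v x)) F + vsum d (\<lambda>j. B j *\<^sub>v (r j *\<^sub>v u)) F
      + vsum d (\<lambda>j. B j *\<^sub>v w j) F"
    by (subst vsum_add; simp?)+
  finally show ?thesis using assms
    by (subst next_state_eq) (auto intro!: eq_vecI simp del: index_mult_mat_vec)
qed

lemma resp_foc:
  assumes x: "dim_vec x = d" and u: "dim_vec u = cdim G 1" and i: "i \<in> F"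
  shows "foc i (next_state G k x ((resp x u)(1 := u))) (resp x u i) = 0\<^sub>v (cdim G i)"
proof -
  have "resp x u i = w i + W i *\<^sub>v x + r i *\<^sub>v u"
    using i by (intro eq_vecI) (auto simp: resp_def simp del: index_mult_mat_vec)
  then show ?thesis
    unfolding next_state_resp[OF x u] using i x u w_sys
    by (simp add: foc_add r_foc W_foc w_system_iff)
qed

text \<open>The difference \<open>e\<close> from \<open>resp\<close> solves the homogeneous
  conditions, which involve neither \<open>x\<close> nor \<open>u\<close>. Hence
  \<open>w + e\<close> solves the system for \<open>w\<close>, and unique solvability of that system
  at state 0 settles all \<open>x\<close> and \<open>u\<close>.\<close>

lemma foc_unique:
  assumes x: "dim_vec x = d" and u: "dim_vec u = cdim G 1"
    and v: "\<And>j. j \<in> F \<Longrightarrow> dim_vec (v j) = cdim G j"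
    and foc: "\<And>j. j \<in> F \<Longrightarrow> foc j (next_state G k x (v(1 := u))) (v j) = 0\<^sub>v (cdim G j)"
    and i: "i \<in> F"
  shows "v i = resp x u i"
proof -
  define e where "e j = v j - resp x u j" for j
  have e [simp]: "dim_vec (e j) = cdim G j" if "j \<in> F" for j using that by (simp add: e_def)
  have ve: "v j = resp x u j + e j" if "j \<in> F" for j
    using v that by (intro eq_vecI) (auto simp: e_def)
  let ?E = "vsum d (\<lambda>j. B j *\<^sub>v e j) F"
  have "vsum d (\<lambda>j. B j *\<^sub>v v j) F = vsum d (\<lambda>j. B j *\<^sub>v resp x u j + B j *\<^sub>v e j) F"
    using v by (intro vsum_cong) (auto simp: ve mult_mat_vec_add)
  also have "\<dots> = vsum d (\<lambda>j. B j *\<^sub>v resp x u j) F + ?E"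
    by (intro vsum_add) auto
  finally have "next_state G k x (v(1 := u)) = next_state G k x ((resp x u)(1 := u)) + ?E"
    using x u v by (simp add: next_state_eq) (auto intro!: eq_vecI simp del: index_mult_mat_vec)
  then have lin0: "foc_linear j ?E (e j) = 0\<^sub>v (cdim G j)" if "j \<in> F" for j
    using foc[OF that] that resp_foc[OF x u that] ve[OF that]
      left_zero_vec[of "foc_linear j ?E (e j)" "cdim G j"]
    by (simp add: foc_add carrier_vecI)
  define w' where "w' j = w j + e j" for j
  have "vsum d (\<lambda>j. B j *\<^sub>v w' j) F = vsum d (\<lambda>j. B j *\<^sub>v w j + B j *\<^sub>v e j) F"
    by (intro vsum_cong) (auto simp: w'_def mult_mat_vec_add)
  also have "\<dots> = vsum d (\<lambda>j. B j *\<^sub>v w j) F + ?E"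
    by (intro vsum_add) auto
  finally have "vsum d (\<lambda>j. B j *\<^sub>v w' j) F + s = (vsum d (\<lambda>j. B j *\<^sub>v w j) F + s) + ?E"
    by (auto intro!: eq_vecI simp del: index_mult_mat_vec)
  then have "w_system G k Z \<zeta> w'"
    using w_sys lin0 by (auto simp: w_system_iff w'_def foc_add intro: carrier_vecI)
  then have "w' i = w i" using w_unique i by (auto simp: unique_solution_on_def)
  then have *: "w i + e i = w i" by (simp add: w'_def)
  have "v i $ l = resp x u i $ l" if "l < cdim G i" for l
    using arg_cong[OF *, of "\<lambda>z. z $ l"] that i by (simp add: e_def)
  then show ?thesis using i v by (intro eq_vecI) simp_all
qed

text \<open>Varying one follower's control with the others fixed is a quadratic problem with Hessian
  \<open>hessian i\<close> and gradient \<open>foc i\<close>.\<close>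

lemma follower_arg_min_iff:
  assumes x: "dim_vec x = d" and i: "i \<in> F"
    and v: "\<And>j. j \<in> N \<Longrightarrow> dim_vec (v j) = cdim G j"
  shows "is_arg_min (\<lambda>z. cost_to_go G V k i x (v(i := z))) (\<lambda>z. z \<in> carrier_vec (cdim G i)) (v i)
    \<longleftrightarrow> foc i (next_state G k x v) (v i) = 0\<^sub>v (cdim G i)"
proof -
  have expand: "cost_to_go G V k i x (v(i := z + h)) = cost_to_go G V k i x (v(i := z))
      + h \<bullet> foc i (next_state G k x (v(i := z))) z + 1/2 * (h \<bullet> (hessian i *\<^sub>v h))"
    if "z \<in> carrier_vec (cdim G i)" "h \<in> carrier_vec (cdim G i)" for z h
  proof -
    have zh [simp]: "dim_vec z = cdim G i" "dim_vec h = cdim G i" using that by auto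
    \<comment> \<open>The perturbation is supported at \<open>i\<close>, so the sums over players
      below reduce to their term at \<open>i\<close>.\<close>
    define \<delta> where "\<delta> j = (if j = i then h else 0\<^sub>v (cdim G j))" for j
    have i': "i \<in> N" using i by simp
    have \<delta> [simp]: "dim_vec (\<delta> j) = cdim G j" for j by (simp add: \<delta>_def)
    have "vsum d (\<lambda>j. B j *\<^sub>v \<delta> j) (N - {i}) $ l = 0" if "l < d" for l
    proof -
      have "vsum d (\<lambda>j. B j *\<^sub>v \<delta> j) (N - {i}) $ l = (\<Sum>j\<in>N - {i}. (B j *\<^sub>v \<delta> j) $ l)"
        using that by (intro index_vsum) auto
      also have "\<dots> = 0"
        using that by (intro sum.neutral) (auto simp: \<delta>_def intro!: scalar_prod_right_zero carrier_vecI)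
      finally show ?thesis .
    qed
    then have "vsum d (\<lambda>j. B j *\<^sub>v \<delta> j) (N - {i}) = 0\<^sub>v d"
      by (intro eq_vecI) auto
    then have vs: "vsum d (\<lambda>j. B j *\<^sub>v \<delta> j) N = B i *\<^sub>v h"
      using i' by (subst vsum_remove[of _ i]) (auto simp: \<delta>_def)
    have "cost_to_go G V k i x (v(i := z + h)) = cost_to_go G V k i x (v(i := z))
      + (B i *\<^sub>v h) \<bullet> costate i (next_state G k x (v(i := z))) + 1/2 * ((B i *\<^sub>v h) \<bullet> (Z i *\<^sub>v (B i *\<^sub>v h)))
      + (\<Sum>j\<in>N. \<delta> j \<bullet> (R i j *\<^sub>v ((v(i := z)) j - ut i j))) + 1/2 * (\<Sum>j\<in>N. \<delta> j \<bullet> (R i j *\<^sub>v \<delta> j))"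
      using i v by (intro cost_to_go_add vs) (auto simp: \<delta>_def)
    moreover have "(\<Sum>j\<in>N. \<delta> j \<bullet> (R i j *\<^sub>v ((v(i := z)) j - ut i j))) = h \<bullet> (R i i *\<^sub>v (z - ut i i))"
      using i' by (subst sum.remove[of _ i]) (auto simp: \<delta>_def intro!: sum.neutral scalar_prod_left_zero carrier_vecI)
    moreover have "(\<Sum>j\<in>N. \<delta> j \<bullet> (R i j *\<^sub>v \<delta> j)) = h \<bullet> (R i i *\<^sub>v h)"
      using i' by (subst sum.remove[of _ i]) (auto simp: \<delta>_def intro!: sum.neutral scalar_prod_left_zero carrier_vecI)
    ultimately show ?thesis using i'
      by (simp add: foc_def hessian_mult_vec scalar_prod_add_right scalar_prod_transpose_mult algebra_simps)
  qed
  have "is_arg_min (\<lambda>z. cost_to_go G V k i x (v(i := z))) (\<lambda>z. z \<in> carrier_vec (cdim G i)) (v i)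
    \<longleftrightarrow> v i \<in> carrier_vec (cdim G i) \<and> foc i (next_state G k x (v(i := v i))) (v i) = 0\<^sub>v (cdim G i)"
  proof (rule is_arg_min_iff_gradient_zero[where M = "hessian i"])
    show "pos_semidef (cdim G i) (hessian i)"
      using i by (intro pos_def_imp_pos_semidef hessian_pd) simp
    show "foc i (next_state G k x (v(i := z))) z \<in> carrier_vec (cdim G i)" for z
      using i by (intro carrier_vecI) simp
  qed (rule expand)
  moreover have "v i \<in> carrier_vec (cdim G i)" using i v by (intro carrier_vecI) simp
  ultimately show ?thesis by simp
qed

text \<open>A Nash equilibrium of the followers means that all their first-order conditions hold at
  one common reached state. \<open>resp_foc\<close> gives existence and \<open>foc_unique\<close>
  uniqueness.\<close>

lemma follower_response_iff:
  assumes x: "x \<in> carrier_vec d" and u: "u \<in> carrier_vec (cdim G 1)"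
  shows "follower_response G V k x u v \<longleftrightarrow> v = resp x u"
proof
  assume a: "follower_response G V k x u v"
  then have v: "v \<in> PiE F (\<lambda>i. carrier_vec (cdim G i))" by (simp add: follower_response_def)
  have vd: "dim_vec (v j) = cdim G j" if "j \<in> F" for j using PiE_mem[OF v that] by auto
  have dv: "dim_vec ((v(1 := u)) j) = cdim G j" if "j \<in> N" for j
    using vd u that unfolding N_eq by auto
  have "foc j (next_state G k x (v(1 := u))) (v j) = 0\<^sub>v (cdim G j)" if "j \<in> F" for j
    using follower_arg_min_iff[of x j "v(1 := u)"] a that x dv
    by (simp add: follower_response_def)
  then have "v j = resp x u j" if "j \<in> F" for j
    using foc_unique[of x u v j] x u vd that by auto
  \<comment> \<open>Off the followers both extensional functions take the default value.\<close>
  moreover have "v j = undefined" "resp x u j = undefined" if "j \<notin> F" for j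
    using v that by (auto simp: resp_def)
  ultimately show "v = resp x u" by (intro ext) metis
next
  assume v: "v = resp x u"
  have dv: "dim_vec ((v(1 := u)) j) = cdim G j" if "j \<in> N" for j
    using u that unfolding N_eq v by auto
  have "v \<in> PiE F (\<lambda>i. carrier_vec (cdim G i))"
    using v by (auto simp: resp_def intro!: carrier_vecI)
  moreover have "is_arg_min (\<lambda>z. cost_to_go G V k j x (v(1 := u, j := z)))
          (\<lambda>z. z \<in> carrier_vec (cdim G j)) (v j)" if "j \<in> F" for j
    using follower_arg_min_iff[of x j "v(1 := u)"] that x u dv resp_foc[of x u j] v by auto
  ultimately show "follower_response G V k x u v" by (simp add: follower_response_def)
qed

lemma reaction_eq:
  assumes "x \<in> carrier_vec d" "u \<in> carrier_vec (cdim G 1)"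
  shows "reaction G V k x u = resp x u"
  using assms by (simp add: reaction_def follower_response_iff)

subsection \<open>The leader and the value recursion\<close>

abbreviation "BB \<equiv> Bbar G k r"
abbreviation "D \<equiv> Delta G k Z r"

lemma dim_BB [simp]: "dim_row BB = d" "dim_col BB = cdim G 1"
  by (simp_all add: Bbar_def)

text \<open>The displacement of the state caused by a leader's move \<open>u\<close>, directly and
  through the followers' replies.\<close>

lemma BB_mult_vec:
  "dim_vec u = cdim G 1 \<Longrightarrow> BB *\<^sub>v u = B 1 *\<^sub>v u + vsum d (\<lambda>j. B j *\<^sub>v (r j *\<^sub>v u)) F"
  using msum_B_mult_vec[of F r u] by (simp add: Bbar_def mat_add_mult_vec)

lemma dim_vsum_r [simp]: "dim_vec (vsum (cdim G 1) (\<lambda>j. (r j)\<^sup>T *\<^sub>v f j) F) = cdim G 1"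
  by (intro dim_vsum) auto

lemma rRr_carrier: "j \<in> F \<Longrightarrow> (r j)\<^sup>T * R 1 j * r j \<in> carrier_mat (cdim G 1) (cdim G 1)"
  by (intro carrier_matI) auto

text \<open>The leader's own weight \<open>R 1 1\<close> is definite and the other summands are
  congruences of semidefinite matrices.\<close>

lemma D_pd: "pos_def (cdim G 1) D"
proof -
  have *: "pos_semidef (cdim G 1) ((r j)\<^sup>T * R 1 j * r j)" if "j \<in> F" for j
    using that by (intro pos_semidef_congruence[of "cdim G j"] R_psd carrier_matI) auto
  have Z1: "pos_semidef (cdim G 1) (BB\<^sup>T * Z 1 * BB)"
    by (intro pos_semidef_congruence[of d] Z_psd carrier_matI) auto
  then have "BB\<^sup>T * Z 1 * BB + R 1 1 = R 1 1 + BB\<^sup>T * Z 1 * BB"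
    using R_carrier[of 1 1] by (intro comm_add_mat) (auto simp: pos_semidef_def sym_mat_def)
  then have "pos_def (cdim G 1) (BB\<^sup>T * Z 1 * BB + R 1 1)"
    using pos_def_add[OF R_pd[of 1] Z1] by simp
  then show ?thesis unfolding Delta_def
    by (rule pos_def_add) (intro pos_semidef_msum *, auto)
qed

lemma dim_D [simp]: "dim_row D = cdim G 1" "dim_col D = cdim G 1"
  using D_pd by (auto simp: pos_def_def sym_mat_def)

lemma D_mult_vec:
  assumes "dim_vec u = cdim G 1"
  shows "D *\<^sub>v u = BB\<^sup>T *\<^sub>v (Z 1 *\<^sub>v (BB *\<^sub>v u)) + R 1 1 *\<^sub>v u
    + vsum (cdim G 1) (\<lambda>j. (r j)\<^sup>T *\<^sub>v (R 1 j *\<^sub>v (r j *\<^sub>v u))) F"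
proof -
  have "msum (cdim G 1) (cdim G 1) (\<lambda>j. (r j)\<^sup>T * R 1 j * r j) F *\<^sub>v u
      = vsum (cdim G 1) (\<lambda>j. ((r j)\<^sup>T * R 1 j * r j) *\<^sub>v u) F"
    using assms by (intro msum_mult_vec rRr_carrier) auto
  also have "\<dots> = vsum (cdim G 1) (\<lambda>j. (r j)\<^sup>T *\<^sub>v (R 1 j *\<^sub>v (r j *\<^sub>v u))) F"
    using assms by (intro vsum_cong) (auto simp: mat_mult_mult_vec)
  moreover have "dim_row (msum (cdim G 1) (cdim G 1) (\<lambda>j. (r j)\<^sup>T * R 1 j * r j) F) = cdim G 1"
    "dim_col (msum (cdim G 1) (cdim G 1) (\<lambda>j. (r j)\<^sup>T * R 1 j * r j) F) = cdim G 1"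
    by (intro dim_msum; simp)+
  ultimately show ?thesis using assms
    by (simp add: Delta_def mat_add_mult_vec mat_mult_mult_vec)
qed

lemma dim_minv_D [simp]: "dim_row (minv D) = cdim G 1" "dim_col (minv D) = cdim G 1"
  using pos_def_minv(1)[OF D_pd] by auto

lemma dim_rRW [simp]:
  "dim_row (msum (cdim G 1) d (\<lambda>j. (r j)\<^sup>T * R 1 j * W j) F) = cdim G 1"
  "dim_col (msum (cdim G 1) d (\<lambda>j. (r j)\<^sup>T * R 1 j * W j) F) = d"
  by (intro dim_msum; simp)+

lemma dim_P [simp]:
  assumes "j \<in> N"
  shows "dim_row (P j) = cdim G j" "dim_col (P j) = d"
proof -
  have "dim_row (P 1) = cdim G 1" "dim_col (P 1) = d"
    unfolding leader leader_P_def by simp_all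
  then show "dim_row (P j) = cdim G j" "dim_col (P j) = d"
    using assms chain(1)[of j] unfolding N_eq by auto
qed

lemma dim_alpha [simp]:
  assumes "j \<in> N"
  shows "dim_vec (\<alpha> j) = cdim G j"
proof -
  have "dim_vec (\<alpha> 1) = cdim G 1"
    unfolding leader leader_alpha_def by simp
  then show "dim_vec (\<alpha> j) = cdim G j"
    using assms chain(2)[of j] unfolding N_eq by auto
qed

text \<open>Multiplying by \<open>D\<close> clears the inverse in the leader's formula. What remains
  is the part of the leader's gradient that is linear in \<open>x\<close>; \<open>D_alpha1\<close>
  yields the constant part.\<close>

lemma D_P1:
  assumes x: "dim_vec x = d"
  shows "D *\<^sub>v (P 1 *\<^sub>v x) =
    BB\<^sup>T *\<^sub>v (Z 1 *\<^sub>v (A *\<^sub>v x + vsum d (\<lambda>j. B j *\<^sub>v (W j *\<^sub>v x)) F))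
    + vsum (cdim G 1) (\<lambda>j. (r j)\<^sup>T *\<^sub>v (R 1 j *\<^sub>v (W j *\<^sub>v x))) F"
proof -
  have 1: "msum (cdim G 1) d (\<lambda>j. (r j)\<^sup>T * R 1 j * W j) F *\<^sub>v x
      = vsum (cdim G 1) (\<lambda>j. ((r j)\<^sup>T * R 1 j * W j) *\<^sub>v x) F"
    using x by (intro msum_mult_vec carrier_matI) auto
  have 2: "vsum (cdim G 1) (\<lambda>j. ((r j)\<^sup>T * R 1 j * W j) *\<^sub>v x) F
      = vsum (cdim G 1) (\<lambda>j. (r j)\<^sup>T *\<^sub>v (R 1 j *\<^sub>v (W j *\<^sub>v x))) F"
    using x by (intro vsum_cong) (auto simp: mat_mult_mult_vec)
  have 3: "msum d d (\<lambda>j. B j * W j) F *\<^sub>v x = vsum d (\<lambda>j. B j *\<^sub>v (W j *\<^sub>v x)) F"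
    using msum_B_mult_vec[of F W x] x by simp
  show ?thesis unfolding leader leader_P_def using x
    by (simp add: mat_mult_mult_vec pos_def_mult_minv_vec[OF D_pd] mat_add_mult_vec 1 2 3)
qed

lemma D_alpha1:
  "D *\<^sub>v \<alpha> 1 =
    BB\<^sup>T *\<^sub>v (Z 1 *\<^sub>v (vsum d (\<lambda>j. B j *\<^sub>v w j) F + s))
    + vsum (cdim G 1) (\<lambda>j. (r j)\<^sup>T *\<^sub>v (R 1 j *\<^sub>v w j)) F - R 1 1 *\<^sub>v ut 1 1
    - vsum (cdim G 1) (\<lambda>j. (r j)\<^sup>T *\<^sub>v (R 1 j *\<^sub>v ut 1 j)) F + BB\<^sup>T *\<^sub>v (\<zeta> 1 - Q 1 *\<^sub>v xt 1)"
proof -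
  have 1: "vsum (cdim G 1) (\<lambda>j. ((r j)\<^sup>T * R 1 j) *\<^sub>v w j) F
      = vsum (cdim G 1) (\<lambda>j. (r j)\<^sup>T *\<^sub>v (R 1 j *\<^sub>v w j)) F"
    by (intro vsum_cong) (auto simp: mat_mult_mult_vec)
  have 2: "vsum (cdim G 1) (\<lambda>j. ((r j)\<^sup>T * R 1 j) *\<^sub>v ut 1 j) F
      = vsum (cdim G 1) (\<lambda>j. (r j)\<^sup>T *\<^sub>v (R 1 j *\<^sub>v ut 1 j)) F"
    by (intro vsum_cong) (auto simp: mat_mult_mult_vec)
  have 3: "s + vsum d (\<lambda>j. B j *\<^sub>v w j) F = vsum d (\<lambda>j. B j *\<^sub>v w j) F + s"
    by (intro comm_add_vec[of _ d] carrier_vecI) auto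
  show ?thesis unfolding leader leader_alpha_def
    by (simp add: pos_def_mult_minv_vec[OF D_pd] mat_mult_mult_vec 1 2 3)
qed

text \<open>The gradient of the leader's cost along the reactions. By the chain rule, follower
  \<open>j\<close> contributes through the derivative \<open>r j\<close> of its response.\<close>

definition leader_foc :: "real vec \<Rightarrow> real vec \<Rightarrow> real vec" where
  "leader_foc x u = BB\<^sup>T *\<^sub>v costate 1 (next_state G k x ((resp x u)(1 := u))) + R 1 1 *\<^sub>v (u - ut 1 1)
    + vsum (cdim G 1) (\<lambda>j. (r j)\<^sup>T *\<^sub>v (R 1 j *\<^sub>v (resp x u j - ut 1 j))) F"

lemma leader_foc_eq:
  assumes x: "dim_vec x = d" and u: "dim_vec u = cdim G 1"
  shows "leader_foc x u = D *\<^sub>v u + D *\<^sub>v (P 1 *\<^sub>v x) + D *\<^sub>v \<alpha> 1"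
proof -
  have "vsum (cdim G 1) (\<lambda>j. (r j)\<^sup>T *\<^sub>v (R 1 j *\<^sub>v (resp x u j - ut 1 j))) F
    = vsum (cdim G 1) (\<lambda>j. (r j)\<^sup>T *\<^sub>v (R 1 j *\<^sub>v (W j *\<^sub>v x)) + (r j)\<^sup>T *\<^sub>v (R 1 j *\<^sub>v (r j *\<^sub>v u))
        + (r j)\<^sup>T *\<^sub>v (R 1 j *\<^sub>v w j) - (r j)\<^sup>T *\<^sub>v (R 1 j *\<^sub>v ut 1 j)) F"
    using x u by (intro vsum_cong) (auto simp: resp_def mult_mat_vec_add mult_mat_vec_minus)
  also have "\<dots> = vsum (cdim G 1) (\<lambda>j. (r j)\<^sup>T *\<^sub>v (R 1 j *\<^sub>v (W j *\<^sub>v x))) F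
      + vsum (cdim G 1) (\<lambda>j. (r j)\<^sup>T *\<^sub>v (R 1 j *\<^sub>v (r j *\<^sub>v u))) F
      + vsum (cdim G 1) (\<lambda>j. (r j)\<^sup>T *\<^sub>v (R 1 j *\<^sub>v w j)) F
      - vsum (cdim G 1) (\<lambda>j. (r j)\<^sup>T *\<^sub>v (R 1 j *\<^sub>v ut 1 j)) F"
    by (simp add: vsum_add vsum_minus)
  finally have v: "vsum (cdim G 1) (\<lambda>j. (r j)\<^sup>T *\<^sub>v (R 1 j *\<^sub>v (resp x u j - ut 1 j))) F = \<dots>" .
  show ?thesis
    unfolding leader_foc_def v next_state_resp[OF x u] BB_mult_vec[OF u, symmetric] D_P1[OF x] D_alpha1
      D_mult_vec[OF u] costate_def
    using x u
    by (intro eq_vecI)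
      (simp_all add: mult_mat_vec_add mult_mat_vec_minus del: index_mult_mat_vec)
qed

lemma leader_foc_eq_zero_iff:
  assumes x: "dim_vec x = d" and u: "dim_vec u = cdim G 1"
  shows "leader_foc x u = 0\<^sub>v (cdim G 1) \<longleftrightarrow> u = - (P 1 *\<^sub>v x) - \<alpha> 1"
proof -
  have "leader_foc x u = D *\<^sub>v (u + P 1 *\<^sub>v x + \<alpha> 1)"
    using x u by (simp add: leader_foc_eq mult_mat_vec_add)
  moreover have "D *\<^sub>v (u + P 1 *\<^sub>v x + \<alpha> 1) = 0\<^sub>v (cdim G 1)
      \<longleftrightarrow> u + P 1 *\<^sub>v x + \<alpha> 1 = 0\<^sub>v (cdim G 1)" (is "?l \<longleftrightarrow> ?r")
  proof
    show "?l \<Longrightarrow> ?r"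
      by (rule pos_def_mult_eq_zero[OF D_pd], rule carrier_vecI) simp_all
    have "D *\<^sub>v 0\<^sub>v (cdim G 1) = 0\<^sub>v (cdim G 1)"
      by (intro eq_vecI) (simp_all add: carrier_vecI scalar_prod_right_zero[of _ "cdim G 1"])
    then show "?r \<Longrightarrow> ?l" by (simp only:)
  qed
  ultimately have "leader_foc x u = 0\<^sub>v (cdim G 1) \<longleftrightarrow> u + P 1 *\<^sub>v x + \<alpha> 1 = 0\<^sub>v (cdim G 1)"
    by metis
  also have "\<dots> \<longleftrightarrow> u = - (P 1 *\<^sub>v x) - \<alpha> 1"
  proof
    assume a: "u + P 1 *\<^sub>v x + \<alpha> 1 = 0\<^sub>v (cdim G 1)"
    have "u $ l = (- (P 1 *\<^sub>v x) - \<alpha> 1) $ l" if "l < cdim G 1" for l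
      using arg_cong[OF a, of "\<lambda>z. z $ l"] that by (simp del: index_mult_mat_vec)
    then show "u = - (P 1 *\<^sub>v x) - \<alpha> 1" using u by (intro eq_vecI) simp_all
  next
    assume "u = - (P 1 *\<^sub>v x) - \<alpha> 1"
    then show "u + P 1 *\<^sub>v x + \<alpha> 1 = 0\<^sub>v (cdim G 1)"
      by (intro eq_vecI) (simp_all del: index_mult_mat_vec)
  qed
  finally show ?thesis .
qed

text \<open>Responses are affine in the leader's control, so a leader's move \<open>h\<close> shifts
  follower \<open>j\<close> by exactly \<open>r j h\<close> and the expansion stays exact, with
  Hessian \<open>D\<close>.\<close>

lemma leader_cost_add:
  assumes x: "dim_vec x = d" and u: "dim_vec u = cdim G 1" and h: "dim_vec h = cdim G 1"
  shows "cost_to_go G V k 1 x ((resp x (u + h))(1 := u + h)) = cost_to_go G V k 1 x ((resp x u)(1 := u))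
    + h \<bullet> leader_foc x u + 1/2 * (h \<bullet> (D *\<^sub>v h))"
proof -
  define \<delta> where "\<delta> j = (if j = 1 then h else r j *\<^sub>v h)" for j
  let ?v = "(resp x u)(1 := u)"
  have v: "dim_vec (?v j) = cdim G j" if "j \<in> N" for j
    using that u unfolding N_eq by auto
  have \<delta>: "dim_vec (\<delta> j) = cdim G j" if "j \<in> N" for j
    using that h unfolding N_eq by (auto simp: \<delta>_def)
  have \<delta>1: "\<delta> 1 = h" by (simp add: \<delta>_def)
  have \<delta>F: "\<delta> j = r j *\<^sub>v h" if "j \<in> F" for j
    using that by (auto simp: \<delta>_def)
  have vs: "vsum d (\<lambda>j. B j *\<^sub>v \<delta> j) N = BB *\<^sub>v h"
  proof -
    have "vsum d (\<lambda>j. B j *\<^sub>v \<delta> j) F = vsum d (\<lambda>j. B j *\<^sub>v (r j *\<^sub>v h)) F"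
      by (intro vsum_cong) (auto simp: \<delta>F)
    then show ?thesis using h by (subst vsum_N) (auto simp: \<delta>1 BB_mult_vec)
  qed
  have "cost_to_go G V k 1 x ((resp x (u + h))(1 := u + h)) = cost_to_go G V k 1 x ?v
      + (BB *\<^sub>v h) \<bullet> costate 1 (next_state G k x ?v) + 1/2 * ((BB *\<^sub>v h) \<bullet> (Z 1 *\<^sub>v (BB *\<^sub>v h)))
      + (\<Sum>j\<in>N. \<delta> j \<bullet> (R 1 j *\<^sub>v (?v j - ut 1 j))) + 1/2 * (\<Sum>j\<in>N. \<delta> j \<bullet> (R 1 j *\<^sub>v \<delta> j))"
  proof (rule cost_to_go_add[OF one_in_N v \<delta> _ vs])
    fix j assume "j \<in> N"
    then consider "j = 1" | "j \<in> F" unfolding N_eq by auto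
    then show "((resp x (u + h))(1 := u + h)) j = ?v j + \<delta> j"
    proof cases
      case 2
      have "W j *\<^sub>v x + r j *\<^sub>v (u + h) + w j = W j *\<^sub>v x + r j *\<^sub>v u + w j + r j *\<^sub>v h"
        using 2 u h by (intro eq_vecI) (simp_all add: mult_mat_vec_add del: index_mult_mat_vec)
      then show ?thesis using 2 by (simp add: resp_def \<delta>F)
    qed (simp add: \<delta>1)
  qed
  moreover have "(\<Sum>j\<in>N. \<delta> j \<bullet> (R 1 j *\<^sub>v (?v j - ut 1 j))) = h \<bullet> (R 1 1 *\<^sub>v (u - ut 1 1))
      + h \<bullet> vsum (cdim G 1) (\<lambda>j. (r j)\<^sup>T *\<^sub>v (R 1 j *\<^sub>v (resp x u j - ut 1 j))) F"
    unfolding sum_N using h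
    by (simp add: \<delta>1 \<delta>F scalar_prod_vsum scalar_prod_transpose_mult)
  moreover have "(\<Sum>j\<in>N. \<delta> j \<bullet> (R 1 j *\<^sub>v \<delta> j)) = h \<bullet> (R 1 1 *\<^sub>v h)
      + h \<bullet> vsum (cdim G 1) (\<lambda>j. (r j)\<^sup>T *\<^sub>v (R 1 j *\<^sub>v (r j *\<^sub>v h))) F"
    unfolding sum_N using h
    by (simp add: \<delta>1 \<delta>F scalar_prod_vsum scalar_prod_transpose_mult)
  ultimately show ?thesis using h u
    by (simp add: leader_foc_def D_mult_vec scalar_prod_add_right scalar_prod_transpose_mult algebra_simps)
qed

lemma leader_arg_min_iff:
  assumes x: "x \<in> carrier_vec d"
  shows "is_arg_min (\<lambda>u. cost_to_go G V k 1 x ((reaction G V k x u)(1 := u)))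
      (\<lambda>u. u \<in> carrier_vec (cdim G 1)) u \<longleftrightarrow> u = - (P 1 *\<^sub>v x) - \<alpha> 1"
proof -
  have "is_arg_min (\<lambda>u. cost_to_go G V k 1 x ((reaction G V k x u)(1 := u)))
      (\<lambda>u. u \<in> carrier_vec (cdim G 1)) u
    \<longleftrightarrow> u \<in> carrier_vec (cdim G 1) \<and> leader_foc x u = 0\<^sub>v (cdim G 1)"
  proof (rule is_arg_min_iff_gradient_zero[OF pos_def_imp_pos_semidef[OF D_pd]])
    fix v h :: "real vec" assume vh: "v \<in> carrier_vec (cdim G 1)" "h \<in> carrier_vec (cdim G 1)"
    show "cost_to_go G V k 1 x ((reaction G V k x (v + h))(1 := v + h)) =
       cost_to_go G V k 1 x ((reaction G V k x v)(1 := v)) + h \<bullet> leader_foc x v + 1/2 * (h \<bullet> (D *\<^sub>v h))"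
      using leader_cost_add[of x v h] x vh by (simp add: reaction_eq)
  qed (rule carrier_vecI, simp add: leader_foc_def)
  also have "\<dots> \<longleftrightarrow> u = - (P 1 *\<^sub>v x) - \<alpha> 1"
  proof
    assume "u \<in> carrier_vec (cdim G 1) \<and> leader_foc x u = 0\<^sub>v (cdim G 1)"
    then show "u = - (P 1 *\<^sub>v x) - \<alpha> 1"
      using leader_foc_eq_zero_iff[OF carrier_vecD[OF x] carrier_vecD[of u "cdim G 1"]] by blast
  next
    assume u: "u = - (P 1 *\<^sub>v x) - \<alpha> 1"
    have "dim_vec u = cdim G 1" unfolding u by simp
    then show "u \<in> carrier_vec (cdim G 1) \<and> leader_foc x u = 0\<^sub>v (cdim G 1)"
      using leader_foc_eq_zero_iff[OF carrier_vecD[OF x], of u] u carrier_vecI by blast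
  qed
  finally show ?thesis .
qed

text \<open>Substituting the leader's feedback law into the affine response gives the follower's law
  by the identities \<open>chain\<close>.\<close>

lemma resp_leader:
  assumes x: "x \<in> carrier_vec d" and i: "i \<in> F"
  shows "resp x (- (P 1 *\<^sub>v x) - \<alpha> 1) i = - (P i *\<^sub>v x) - \<alpha> i"
proof -
  have [simp]: "dim_vec x = d" using x by auto
  have "P i *\<^sub>v x = - (W i *\<^sub>v x) + r i *\<^sub>v (P 1 *\<^sub>v x)"
    unfolding chain(1)[OF i] using i by (simp add: mat_add_mult_vec mat_mult_mult_vec)
  then show ?thesis unfolding chain(2)[OF i] using i
    by (intro eq_vecI)
      (simp_all add: resp_def mult_mat_vec_minus mult_mat_vec_uminus del: index_mult_mat_vec)
qed

section \<open>The closed loop and the recursion for the values\<close>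

abbreviation "C \<equiv> closed_loop G k P"

lemma dim_BP [simp]:
  "dim_row (msum d d (\<lambda>j. B j * P j) N) = d" "dim_col (msum d d (\<lambda>j. B j * P j) N) = d"
  by (intro dim_msum; simp)+

lemma dim_C [simp]: "dim_row C = d" "dim_col C = d"
  by (simp_all add: closed_loop_def)

lemma dim_sbar [simp]: "dim_vec (sbar G k \<alpha>) = d"
  by (simp add: sbar_def)

lemma C_mult_vec:
  assumes "dim_vec x = d"
  shows "C *\<^sub>v x = A *\<^sub>v x - vsum d (\<lambda>j. B j *\<^sub>v (P j *\<^sub>v x)) N"
proof -
  have "msum d d (\<lambda>j. B j * P j) N *\<^sub>v x = vsum d (\<lambda>j. (B j * P j) *\<^sub>v x) N"
    using assms by (intro msum_mult_vec carrier_matI) auto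
  also have "\<dots> = vsum d (\<lambda>j. B j *\<^sub>v (P j *\<^sub>v x)) N"
    using assms by (intro vsum_cong) (auto simp: mat_mult_mult_vec)
  finally show ?thesis using assms by (simp add: closed_loop_def mat_minus_mult_vec)
qed

text \<open>\<open>sbar G k \<alpha>\<close> is the state reached from 0 and serves as base point of
  the expansion in \<open>value_step\<close>; \<open>C x\<close> is the increment.\<close>

lemma next_state_feedback:
  assumes "dim_vec x = d"
  shows "next_state G k x (\<lambda>j. - (P j *\<^sub>v x) - \<alpha> j) = sbar G k \<alpha> + C *\<^sub>v x"
proof -
  have "vsum d (\<lambda>j. B j *\<^sub>v (- (P j *\<^sub>v x) - \<alpha> j)) N
    = vsum d (\<lambda>j. - (B j *\<^sub>v (P j *\<^sub>v x)) - B j *\<^sub>v \<alpha> j) N"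
    using assms by (intro vsum_cong) (auto simp: mult_mat_vec_minus mult_mat_vec_uminus)
  also have "\<dots> = - vsum d (\<lambda>j. B j *\<^sub>v (P j *\<^sub>v x)) N - vsum d (\<lambda>j. B j *\<^sub>v \<alpha> j) N"
    by (simp add: vsum_minus vsum_uminus)
  finally show ?thesis using assms
    by (auto intro!: eq_vecI simp: next_state_def sbar_def C_mult_vec simp del: index_mult_mat_vec)
qed

lemma PRP_carrier: "i \<in> N \<Longrightarrow> j \<in> N \<Longrightarrow> (P j)\<^sup>T * R i j * P j \<in> carrier_mat d d"
  by (intro carrier_matI) auto

lemma Z_step_psd:
  "i \<in> N \<Longrightarrow> pos_semidef d (Qmat G (k - 1) i) \<Longrightarrow> pos_semidef d (Z_step G k Z P i)"
  unfolding Z_step_def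
  by (intro pos_semidef_add pos_semidef_msum pos_semidef_congruence[OF Z_psd]
      pos_semidef_congruence[OF R_psd] carrier_matI) auto

lemma zeta_step_carrier: "i \<in> N \<Longrightarrow> zeta_step G k Z \<zeta> P \<alpha> i \<in> carrier_vec d"
  by (intro carrier_vecI) (simp add: zeta_step_def dim_vsum)

lemma Z_step_form:
  assumes i: "i \<in> N" and x: "dim_vec x = d" and Q': "Qmat G (k - 1) i \<in> carrier_mat d d"
  shows "x \<bullet> (Z_step G k Z P i *\<^sub>v x) = (C *\<^sub>v x) \<bullet> (Z i *\<^sub>v (C *\<^sub>v x))
    + (\<Sum>j\<in>N. (P j *\<^sub>v x) \<bullet> (R i j *\<^sub>v (P j *\<^sub>v x))) + x \<bullet> (Qmat G (k - 1) i *\<^sub>v x)"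
proof -
  have q: "dim_row (Qmat G (k - 1) i) = d" "dim_col (Qmat G (k - 1) i) = d" using Q' by auto
  let ?m = "msum d d (\<lambda>j. (P j)\<^sup>T * R i j * P j) N"
  have m: "dim_row ?m = d" "dim_col ?m = d"
    using i by (intro dim_msum; simp)+
  have "?m *\<^sub>v x = vsum d (\<lambda>j. ((P j)\<^sup>T * R i j * P j) *\<^sub>v x) N"
    using i x by (intro msum_mult_vec PRP_carrier) auto
  also have "x \<bullet> \<dots> = (\<Sum>j\<in>N. x \<bullet> (((P j)\<^sup>T * R i j * P j) *\<^sub>v x))"
    using i x by (intro scalar_prod_vsum) auto
  also have "\<dots> = (\<Sum>j\<in>N. (P j *\<^sub>v x) \<bullet> (R i j *\<^sub>v (P j *\<^sub>v x)))"
    using i x by (intro sum.cong refl) (auto simp: mat_mult_mult_vec scalar_prod_transpose_mult)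
  finally have 1: "x \<bullet> (?m *\<^sub>v x) = \<dots>" .
  have "x \<bullet> (Z_step G k Z P i *\<^sub>v x) = (C *\<^sub>v x) \<bullet> (Z i *\<^sub>v (C *\<^sub>v x)) + x \<bullet> (?m *\<^sub>v x)
      + x \<bullet> (Qmat G (k - 1) i *\<^sub>v x)"
    unfolding Z_step_def using i x m q
    by (simp add: mat_add_mult_vec mat_mult_mult_vec scalar_prod_add_right scalar_prod_transpose_mult)
  then show ?thesis unfolding 1 .
qed

lemma zeta_step_form:
  assumes i: "i \<in> N" and x: "dim_vec x = d"
  shows "zeta_step G k Z \<zeta> P \<alpha> i \<bullet> x = (C *\<^sub>v x) \<bullet> costate i (sbar G k \<alpha>)
    + (\<Sum>j\<in>N. (P j *\<^sub>v x) \<bullet> (R i j *\<^sub>v (\<alpha> j + ut i j)))"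
proof -
  let ?v = "vsum d (\<lambda>j. ((P j)\<^sup>T * R i j) *\<^sub>v (\<alpha> j + ut i j)) N"
  have v: "dim_vec ?v = d" using i by (intro dim_vsum) auto
  have "x \<bullet> ?v = (\<Sum>j\<in>N. x \<bullet> (((P j)\<^sup>T * R i j) *\<^sub>v (\<alpha> j + ut i j)))"
    using i x by (intro scalar_prod_vsum) auto
  also have "\<dots> = (\<Sum>j\<in>N. (P j *\<^sub>v x) \<bullet> (R i j *\<^sub>v (\<alpha> j + ut i j)))"
    using i x by (intro sum.cong refl) (auto simp: mat_mult_mult_vec scalar_prod_transpose_mult)
  finally have 1: "x \<bullet> ?v = \<dots>" .
  have 2: "\<zeta> i + Z i *\<^sub>v sbar G k \<alpha> - Q i *\<^sub>v xt i = costate i (sbar G k \<alpha>)"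
    unfolding costate_def using i by (intro eq_vecI) (simp_all del: index_mult_mat_vec)
  have "zeta_step G k Z \<zeta> P \<alpha> i \<bullet> x = x \<bullet> zeta_step G k Z \<zeta> P \<alpha> i"
    using zeta_step_carrier[OF i] x by (intro scalar_prod_comm) auto
  also have "\<dots> = (C *\<^sub>v x) \<bullet> costate i (sbar G k \<alpha>) + x \<bullet> ?v"
    unfolding zeta_step_def 2 using i x v
    by (simp add: scalar_prod_add_right scalar_prod_transpose_mult)
  finally show ?thesis unfolding 1 .
qed

text \<open>The constant term is the cost at state 0, where the feedback controls are the vectors
  \<open>- \<alpha> j\<close>.\<close>

lemma n_step_eq:
  assumes i: "i \<in> N"
  shows "objective i (sbar G k \<alpha>) (\<lambda>j. - \<alpha> j) = n_step G k Z \<zeta> c \<alpha> i"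
proof -
  have 1: "(\<Sum>j\<in>N. (- \<alpha> j) \<bullet> (R i j *\<^sub>v (- \<alpha> j))) = (\<Sum>j\<in>N. \<alpha> j \<bullet> (R i j *\<^sub>v \<alpha> j))"
    using i by (intro sum.cong refl) (simp add: mult_mat_vec_uminus)
  have 2: "(\<Sum>j\<in>N. ut i j \<bullet> (R i j *\<^sub>v (- \<alpha> j))) = - (\<Sum>j\<in>N. ut i j \<bullet> (R i j *\<^sub>v \<alpha> j))"
    unfolding sum_negf[symmetric] using i by (intro sum.cong refl) (simp add: mult_mat_vec_uminus)
  show ?thesis unfolding objective_def stage_cost_def n_step_def 1 2 by (simp add: algebra_simps)
qed

text \<open>Expand at state \<open>sbar G k \<alpha>\<close> and controls
  \<open>- \<alpha> j\<close> with increments \<open>C x\<close> and \<open>- P j x\<close>. The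
  terms of order two, one and zero in \<open>x\<close> are the steps for \<open>Z\<close>, \<zeta>
  and \<open>n\<close>. The weight of stage \<open>k - 1\<close> is subtracted because that state is
  charged in the previous stage cost.\<close>

lemma value_step:
  assumes i: "i \<in> N" and x: "dim_vec x = d" and Q': "Qmat G (k - 1) i \<in> carrier_mat d d"
  shows "cost_to_go G V k i x (\<lambda>j. - (P j *\<^sub>v x) - \<alpha> j) =
    1/2 * (x \<bullet> (Z_step G k Z P i *\<^sub>v x) - x \<bullet> (Qmat G (k - 1) i *\<^sub>v x))
    + zeta_step G k Z \<zeta> P \<alpha> i \<bullet> x + n_step G k Z \<zeta> c \<alpha> i"
proof -
  let ?u = "\<lambda>j. - (P j *\<^sub>v x) - \<alpha> j" and ?v = "\<lambda>j. - \<alpha> j + (- (P j *\<^sub>v x))"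
  have "?u j = ?v j" if "j \<in> N" for j
    using that by (intro eq_vecI) (simp_all del: index_mult_mat_vec)
  then have "cost_to_go G V k i x ?u = objective i (sbar G k \<alpha> + C *\<^sub>v x) ?v"
    using cost_to_go_cong[of G ?u ?v k V i x] cost_to_go_eq_objective[OF i, of x ?v]
      next_state_feedback[OF x] next_state_cong[of G ?u ?v k x] by simp
  also have "\<dots> = objective i (sbar G k \<alpha>) (\<lambda>j. - \<alpha> j) + (C *\<^sub>v x) \<bullet> costate i (sbar G k \<alpha>)
      + 1/2 * ((C *\<^sub>v x) \<bullet> (Z i *\<^sub>v (C *\<^sub>v x)))
      + (\<Sum>j\<in>N. (- (P j *\<^sub>v x)) \<bullet> (R i j *\<^sub>v (- \<alpha> j - ut i j)))
      + 1/2 * (\<Sum>j\<in>N. (- (P j *\<^sub>v x)) \<bullet> (R i j *\<^sub>v (- (P j *\<^sub>v x))))"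
    using i x by (intro objective_add) auto
  also have "(\<Sum>j\<in>N. (- (P j *\<^sub>v x)) \<bullet> (R i j *\<^sub>v (- \<alpha> j - ut i j)))
      = (\<Sum>j\<in>N. (P j *\<^sub>v x) \<bullet> (R i j *\<^sub>v (\<alpha> j + ut i j)))"
    using i x by (intro sum.cong refl)
      (simp add: mult_mat_vec_uminus mult_mat_vec_minus mult_mat_vec_add
        scalar_prod_minus_right scalar_prod_add_right)
  also have "(\<Sum>j\<in>N. (- (P j *\<^sub>v x)) \<bullet> (R i j *\<^sub>v (- (P j *\<^sub>v x))))
      = (\<Sum>j\<in>N. (P j *\<^sub>v x) \<bullet> (R i j *\<^sub>v (P j *\<^sub>v x)))"
    using i x by (intro sum.cong refl) (simp add: mult_mat_vec_uminus)
  finally show ?thesis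
    using i x Q' by (simp add: Z_step_form zeta_step_form n_step_eq)
qed

end

subsection \<open>Backward induction\<close>

theorem theorem5:
  fixes G :: aq_game
    and r W P Z :: "nat \<Rightarrow> nat \<Rightarrow> real mat"
    and w \<alpha> \<zeta> :: "nat \<Rightarrow> nat \<Rightarrow> real vec"
    and n :: "nat \<Rightarrow> nat \<Rightarrow> real"
  defines "\<gamma> \<equiv> \<lambda>k i x. - (P k i *\<^sub>v x) - \<alpha> k i"
  assumes game: "affine_quadratic_game G"
    and definiteness: "\<And>k i. k \<in> stages G \<Longrightarrow> i \<in> players G \<Longrightarrow>
        pos_semidef (sdim G) (Qmat G k i) \<and> pos_def (cdim G i) (Rmat G k i i) \<and>
        (\<forall>j \<in> players G - {i}. pos_semidef (cdim G j) (Rmat G k i j))"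
    and terminal: "\<And>i. i \<in> players G \<Longrightarrow>
        Z (nstages G) i = Qmat G (nstages G) i \<and> \<zeta> (nstages G) i = 0\<^sub>v (sdim G) \<and>
        n (nstages G) i = 0"
    and recursion: "\<And>k i. k \<in> stages G \<Longrightarrow> i \<in> players G \<Longrightarrow>
        Z (k - 1) i = Z_step G k (Z k) (P k) i \<and>
        \<zeta> (k - 1) i = zeta_step G k (Z k) (\<zeta> k) (P k) (\<alpha> k) i \<and>
        n (k - 1) i = n_step G k (Z k) (\<zeta> k) (n k) (\<alpha> k) i"
    and leader: "\<And>k. k \<in> stages G \<Longrightarrow>
        P k 1 = leader_P G k (Z k) (r k) (W k) \<and>
        \<alpha> k 1 = leader_alpha G k (Z k) (\<zeta> k) (r k) (w k)"
    and unique_solutions: "\<And>k. k \<in> stages G \<Longrightarrow>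
        unique_solution_on (followers G) (r_system G k (Z k)) (r k) \<and>
        unique_solution_on (followers G) (W_system G k (Z k)) (W k) \<and>
        unique_solution_on (followers G) (w_system G k (Z k) (\<zeta> k)) (w k) \<and>
        unique_solution_on (followers G) (P_system G k (Z k) (P k 1)) (P k) \<and>
        unique_solution_on (followers G) (alpha_system G k (Z k) (\<zeta> k) (\<alpha> k 1)) (\<alpha> k)"
    and chain: "\<And>k i. k \<in> stages G \<Longrightarrow> i \<in> followers G \<Longrightarrow>
        P k i = - W k i + r k i * P k 1 \<and> \<alpha> k i = - w k i + r k i *\<^sub>v \<alpha> k 1"
  shows "feedback_stackelberg G \<gamma> \<and>
    (\<forall>\<gamma>'. feedback_stackelberg G \<gamma>' \<longrightarrow>
      (\<forall>k \<in> stages G. \<forall>i \<in> players G. \<forall>x \<in> carrier_vec (sdim G). \<gamma>' k i x = \<gamma> k i x)) \<and>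
    (\<forall>V. stackelberg_values G \<gamma> V \<longrightarrow>
      (\<forall>i \<in> players G.
        V i 1 (xinit G) = 1/2 * (xinit G \<bullet> (Z 0 i *\<^sub>v xinit G)) + \<zeta> 0 i \<bullet> xinit G + n 0 i))"
proof -
  \<comment> \<open>The value before stage \<open>k\<close> carries index \<open>k - 1\<close>. At
    \<open>T + 1\<close> it vanishes since \<open>Z\<close> equals \<open>Q\<close> there; at 1 the
    correction disappears since \<open>Q\<close> is zero at index 0.\<close>
  define U where "U i k x = 1/2 * (x \<bullet> (Z (k - 1) i *\<^sub>v x) - x \<bullet> (Qmat G (k - 1) i *\<^sub>v x))
    + \<zeta> (k - 1) i \<bullet> x + n (k - 1) i" for i k x
  let ?T = "nstages G"
  have Q_psd: "pos_semidef (sdim G) (Qmat G k i)" if "i \<in> players G" "k \<le> ?T" for k i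
  proof (cases "k = 0")
    case True
    have "Qmat G 0 i = 0\<^sub>m (sdim G) (sdim G)"
      using game that by (simp add: affine_quadratic_game_def)
    then show ?thesis using True pos_semidef_zero by simp
  next
    case False
    then show ?thesis using definiteness[of k i] that by (simp add: stages_def)
  qed
  \<comment> \<open>\<open>V\<close> stays arbitrary apart from agreeing with \<open>U\<close> at
    the next stage, so the stage results apply to \<open>U\<close> and also to the values of any
    other equilibrium.\<close>
  have solution: "aq_stage_solution G k (Z k) (\<zeta> k) (n k) V (r k) (W k) (P k) (w k) (\<alpha> k)"
    if k: "k \<in> stages G"
      and Zk: "\<And>i. i \<in> players G \<Longrightarrow> pos_semidef (sdim G) (Z k i) \<and> \<zeta> k i \<in> carrier_vec (sdim G)"
      and V: "\<And>i x. i \<in> players G \<Longrightarrow> x \<in> carrier_vec (sdim G) \<Longrightarrow> V i (k + 1) x = U i (k + 1) x"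
    for k V
    by unfold_locales
      (use game k definiteness[OF k] Zk V unique_solutions[OF k] leader[OF k] chain[OF k] in
        \<open>simp_all add: U_def unique_solution_on_def\<close>)
  have Z_zeta: "pos_semidef (sdim G) (Z k i) \<and> \<zeta> k i \<in> carrier_vec (sdim G)"
    if "k \<le> ?T" "i \<in> players G" for k i
    using that
  proof (induction arbitrary: i rule: inc_induct)
    case base
    then show ?case using terminal[of i] Q_psd[of i ?T] by simp
  next
    case (step k)
    have k: "Suc k \<in> stages G" using step.hyps by (simp add: stages_def)
    \<comment> \<open>With \<open>U\<close> as value functions the agreement at the next stage holds
      by reflexivity.\<close>
    interpret aq_stage_solution G "Suc k" "Z (Suc k)" "\<zeta> (Suc k)" "n (Suc k)" U
      "r (Suc k)" "W (Suc k)" "P (Suc k)" "w (Suc k)" "\<alpha> (Suc k)"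
      by (rule solution[where V = U, OF k step.IH refl])
    show ?case
      using recursion[OF k step.prems] Z_step_psd[OF step.prems] zeta_step_carrier[OF step.prems]
        Q_psd[of i k] step by simp
  qed
  have terminal_value: "U i (?T + 1) x = 0" if "i \<in> players G" "x \<in> carrier_vec (sdim G)" for i x
    using terminal[OF that(1)] that(2) by (simp add: U_def)
  have stage:
    "\<exists>!v. follower_response G V k x u v"
    "is_arg_min (\<lambda>u. cost_to_go G V k 1 x ((reaction G V k x u)(1 := u)))
      (\<lambda>u. u \<in> carrier_vec (cdim G 1)) u' \<longleftrightarrow> u' = \<gamma> k 1 x"
    "i \<in> followers G \<Longrightarrow> reaction G V k x (\<gamma> k 1 x) i = \<gamma> k i x"
    "j \<in> players G \<Longrightarrow> cost_to_go G V k j x (\<lambda>l. \<gamma> k l x) = U j k x"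
    if k: "k \<in> stages G"
      and V: "\<And>i x. i \<in> players G \<Longrightarrow> x \<in> carrier_vec (sdim G) \<Longrightarrow> V i (k + 1) x = U i (k + 1) x"
      and x: "x \<in> carrier_vec (sdim G)" and u: "u \<in> carrier_vec (cdim G 1)"
    for k V x u u' i j
  proof -
    have kT: "k \<le> ?T" "k - 1 \<le> ?T" using k by (auto simp: stages_def)
    interpret aq_stage_solution G k "Z k" "\<zeta> k" "n k" V "r k" "W k" "P k" "w k" "\<alpha> k"
      by (rule solution[where V = V, OF k Z_zeta[OF kT(1)] V])
    show "\<exists>!v. follower_response G V k x u v"
      using follower_response_iff[OF x u] by simp
    show "is_arg_min (\<lambda>u. cost_to_go G V k 1 x ((reaction G V k x u)(1 := u)))
      (\<lambda>u. u \<in> carrier_vec (cdim G 1)) u' \<longleftrightarrow> u' = \<gamma> k 1 x"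
      unfolding \<gamma>_def by (rule leader_arg_min_iff[OF x])
    have "\<gamma> k 1 x \<in> carrier_vec (cdim G 1)"
      unfolding \<gamma>_def by (rule carrier_vecI) simp
    then show "reaction G V k x (\<gamma> k 1 x) i = \<gamma> k i x" if "i \<in> followers G"
      using reaction_eq[OF x] resp_leader[OF x that] by (simp add: \<gamma>_def)
    show "cost_to_go G V k j x (\<lambda>l. \<gamma> k l x) = U j k x" if j: "j \<in> players G"
    proof -
      have "Qmat G (k - 1) j \<in> carrier_mat (sdim G) (sdim G)"
        using Q_psd[OF j kT(2)] by (simp add: pos_semidef_def sym_mat_def)
      then show ?thesis
        unfolding \<gamma>_def U_def using value_step[OF j carrier_vecD[OF x]] recursion[OF k j] by simp
    qed
  qed
  \<comment> \<open>The zero control is an arbitrary admissible choice for \<open>u\<close> in the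
    facts about the leader's optimum, the reactions and the values.\<close>
  have equilibrium: "stackelberg_values G \<gamma> U"
    unfolding stackelberg_values_def
    using stage(1)[of _ U] stage(2)[of _ U _ "0\<^sub>v (cdim G 1)"] stage(3,4)[of _ U _ "0\<^sub>v (cdim G 1)"]
      terminal_value by auto
  \<comment> \<open>Strategies and values are determined together, going backward: agreement of the
    values at \<open>k + 1\<close> forces the strategies at stage \<open>k\<close>
    (\<open>eq\<close>), and these force the values at \<open>k\<close> (\<open>val\<close>). The
    shift to \<open>k + 1\<close> lets the induction start at \<open>T\<close> with the terminal
    condition.\<close>
  have value_unique: "V i (k + 1) x = U i (k + 1) x"
    and strategies: "0 < k \<Longrightarrow> \<gamma>' k i x = \<gamma> k i x"
    if V: "stackelberg_values G \<gamma>' V" and "k \<le> ?T" "i \<in> players G" "x \<in> carrier_vec (sdim G)"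
    for \<gamma>' V k i x
  proof -
    have eq: "\<gamma>' k i x = \<gamma> k i x"
      if k: "k \<in> stages G" and i: "i \<in> players G" and x: "x \<in> carrier_vec (sdim G)"
        and V': "\<And>i x. i \<in> players G \<Longrightarrow> x \<in> carrier_vec (sdim G) \<Longrightarrow> V i (k + 1) x = U i (k + 1) x"
      for k i x
    proof -
      note stage' = stage[where V = V, OF k V' x zero_carrier_vec]
      have "is_arg_min (\<lambda>u. cost_to_go G V k 1 x ((reaction G V k x u)(1 := u)))
          (\<lambda>u. u \<in> carrier_vec (cdim G 1)) (\<gamma>' k 1 x)"
        and f: "\<And>i. i \<in> followers G \<Longrightarrow> \<gamma>' k i x = reaction G V k x (\<gamma>' k 1 x) i"
        using V k x unfolding stackelberg_values_def by blast+
      then have l: "\<gamma>' k 1 x = \<gamma> k 1 x" using stage'(2) by blast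
      have "i = 1 \<or> i \<in> followers G" using i by (auto simp: players_def followers_def)
      then show ?thesis using l f stage'(3) by metis
    qed
    have val: "V i (k + 1) x = U i (k + 1) x"
      if "k \<le> ?T" "i \<in> players G" "x \<in> carrier_vec (sdim G)" for k i x
      using that
    proof (induction arbitrary: i x rule: inc_induct)
      case base
      then show ?case using V terminal_value by (simp add: stackelberg_values_def)
    next
      case (step k)
      have k: "Suc k \<in> stages G" using step.hyps by (simp add: stages_def)
      have "V i (Suc k) x = cost_to_go G V (Suc k) i x (\<lambda>j. \<gamma>' (Suc k) j x)"
        using V k step.prems by (simp add: stackelberg_values_def)
      also have "\<dots> = cost_to_go G V (Suc k) i x (\<lambda>j. \<gamma> (Suc k) j x)"
      proof (rule cost_to_go_cong)
        fix j assume j: "j \<in> players G"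
        show "\<gamma>' (Suc k) j x = \<gamma> (Suc k) j x" using eq[OF k j step.prems(2) step.IH] by simp
        have "Bmat G (Suc k) j \<in> carrier_mat (sdim G) (cdim G j)"
          using game k j unfolding affine_quadratic_game_def by blast
        then show "dim_row (Bmat G (Suc k) j) = sdim G" by simp
      qed
      also have "\<dots> = U i (Suc k) x"
        by (rule stage(4)[where V = V, OF k step.IH step.prems(2) zero_carrier_vec step.prems(1)])
      finally show ?case by simp
    qed
    show "V i (k + 1) x = U i (k + 1) x" using val that by blast
    show "\<gamma>' k i x = \<gamma> k i x" if "0 < k"
      using eq[of k i x] val \<open>k \<le> ?T\<close> \<open>i \<in> players G\<close> \<open>x \<in> carrier_vec (sdim G)\<close> that
      by (simp add: stages_def)
  qed
  have "U i 1 (xinit G)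
      = 1/2 * (xinit G \<bullet> (Z 0 i *\<^sub>v xinit G)) + \<zeta> 0 i \<bullet> xinit G + n 0 i" if "i \<in> players G" for i
  proof -
    have "Qmat G 0 i = 0\<^sub>m (sdim G) (sdim G)" "xinit G \<in> carrier_vec (sdim G)"
      using game that by (auto simp: affine_quadratic_game_def)
    then show ?thesis by (simp add: U_def zero_mat_mult_vec)
  qed
  moreover have "xinit G \<in> carrier_vec (sdim G)"
    using game by (simp add: affine_quadratic_game_def)
  ultimately have "V i 1 (xinit G)
      = 1/2 * (xinit G \<bullet> (Z 0 i *\<^sub>v xinit G)) + \<zeta> 0 i \<bullet> xinit G + n 0 i"
    if "stackelberg_values G \<gamma> V" "i \<in> players G" for V i
    using value_unique[OF that(1), of 0 i "xinit G"] that(2) by simp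
  moreover have "\<gamma>' k i x = \<gamma> k i x"
    if "feedback_stackelberg G \<gamma>'" "k \<in> stages G" "i \<in> players G" "x \<in> carrier_vec (sdim G)"
    for \<gamma>' k i x
    using strategies that unfolding feedback_stackelberg_def stages_def by auto
  ultimately show ?thesis
    using equilibrium unfolding feedback_stackelberg_def by blast
qed

end
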